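(* Let $q\in\mathbb{C}$ be a primitive cube root of unity ($r=3$) and let $\square=\delta\mathrm{d}+\mathrm{d}\delta$ be the Laplacian on $\Omega^0=\mathcal{A}$, the reduced quantum group $\mathbb{C}_q[SL_2]$. A basis of the 13-dimensional kernel of $\square$ on $\Omega^0$ is $$1,\ a,\ b,\ c,\ d,\ ab^2,\ a^2b,\ db^2,\ d^2b,\ ac^2,\ a^2c,\ dc^2,\ d^2c.$$ In addition there are 9 linearly independent eigenvectors of $\square$ on $\Omega^0$ of eigenvalue $6(q+1)$, given by $$a^2,\ b^2,\ c^2,\ d^2,\ ab,\ ac,\ db,\ dc,\ bc-1.$$
   Context: Here $q^3=1$, $q\ne1$, $\mu=1-q^{-2}$. $\mathcal{A}$ is the unital $\mathbb{C}$-algebra generated by $a,b,c,d$ with relations $ba=qab$, $ca=qac$, $db=qbd$, $dc=qcd$, $cb=bc$, $da-ad=q\mu bc$, $ad-q^{-1}bc=1$, $a^3=d^3=1$, $b^3=c^3=0$. It has dimension 27 with basis $\{a^mb^nc^k\}_{0\le m,n,k\le2}$. $\Lambda$ is the graded algebra generated by degree-1 elements $e_a,e_b,e_c,e_d$ with relations: $e_b,e_c,e_d$ pairwise anticommute and square to zero; $e_a\wedge e_a=\mu e_b\wedge e_c$; $e_a\wedge e_d+e_d\wedge e_a+\mu e_b\wedge e_c=0$; $e_a\wedge e_b+q^2e_b\wedge e_a-\mu e_b\wedge e_d=0$; $e_c\wedge e_a+q^2e_a\wedge e_c+\mu e_c\wedge e_d=0$. Write $e_{ij\cdots}=e_i\wedge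 e_j\wedge\cdots$; bases in degrees $2,3,4$ are $\{e_{ab},e_{ac},e_{ad},e_{bc},e_{bd},e_{cd}\}$, $\{e_{abc},e_{abd},e_{acd},e_{bcd}\}$, $\{e_{abcd}\}$. $\Omega=\Lambda\otimes\mathcal{A}$ is the free right $\mathcal{A}$-module on $\Lambda$, with algebra structure given by those of $\Lambda$, $\mathcal{A}$ and the following cross relations, where $(u,v)$ is either $(a,c)$ or $(b,d)$: $ve_b=e_bv$, $ue_c=e_cu$, $ue_d=q^{-1}e_du$, $ve_d=qe_dv$, $ue_b=e_bu+q\mu e_dv$, $ve_c=e_cv+q\mu e_du$, $ve_a=q^{-1}e_av+\mu e_bu$, $ue_a=qe_au+\mu e_cv+q\mu^2e_du$. The exterior derivative is $\mathrm{d}\omega=-(\theta\wedge\omega-(-1)^{|\omega|}\omega\wedge\theta)$, $\theta=e_a+e_d$. The Hodge operator $\star:\Omega^i\to\Omega^{4-i}$ is the right $\mathcal{A}$-linear map with $\star1=e_{abcd}$, $\star e_{abcd}=1$, $\star e_a=-e_{abc}-\mu e_{bcd}$, $\star e_b=-e_{abd}$, $\star e_c=q^2e_{acd}$, $\star e_d=e_{bcd}$, $\star e_{ab}=-e_{ab}+2\mu e_{bd}$, $\star e_{ac}=e_{ac}$, $\star e_{ad}=\frac{1}{1+q^2}(2e_{bc}-q^2\mu e_{ad})$, $\star e_{bc}=\frac{q^2}{1+q^2}(2e_{ad}+\mu e_{bc})$, $\star e_{bd}=e_{bd}$, $\star e_{cd}=-e_{cd}$, $\star e_{abc}=-e_a-\mu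 e_d$, $\star e_{abd}=-e_b$, $\star e_{acd}=q^{-2}e_c$, $\star e_{bcd}=e_d$. Set $\delta=\star\circ\mathrm{d}\circ\star$. On $\Omega^0$ one has $\delta=0$, so $\square=\delta\mathrm{d}$ there. *)

theory Defs
  imports Complex_Main "HOL-Library.Poly_Mapping" "HOL-Library.FuncSet"
    "HOL-Algebra.QuotRing" "HOL-Algebra.Embedded_Algebras"
begin

section \<open>Free complex algebras\<close>

datatype gen = Gen_a | Gen_b | Gen_c | Gen_d | Gen_ea | Gen_eb | Gen_ec | Gen_ed

text \<open>Words are a copy of lists, made into an additively written monoid, so that
  the convolution product of \<^theory>\<open>HOL-Library.Poly_Mapping\<close> on finitely supported functions
  is the product of the free (noncommutative) algebra.\<close>

datatype word = Word (letters: "gen list")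

instantiation word :: monoid_add
begin
definition zero_word :: word where "0 = Word []"
definition plus_word :: "word \<Rightarrow> word \<Rightarrow> word" where "v + w = Word (letters v @ letters w)"
instance by standard (simp_all add: zero_word_def plus_word_def)
end

type_synonym falg = "word \<Rightarrow>\<^sub>0 complex"

definition scal :: "complex \<Rightarrow> falg" where
  "scal z = Poly_Mapping.single 0 z"

definition gen :: "gen \<Rightarrow> falg" where
  "gen g = Poly_Mapping.single (Word [g]) 1"

abbreviation "ga \<equiv> gen Gen_a"
abbreviation "gb \<equiv> gen Gen_b"
abbreviation "gc \<equiv> gen Gen_c"
abbreviation "gd \<equiv> gen Gen_d"
abbreviation "ea \<equiv> gen Gen_ea"
abbreviation "eb \<equiv> gen Gen_eb"
abbreviation "ec \<equiv> gen Gen_ec"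
abbreviation "ed \<equiv> gen Gen_ed"

definition free_ring :: "gen set \<Rightarrow> falg ring" where
  "free_ring S = \<lparr>carrier = {p. \<forall>w \<in> Poly_Mapping.keys p. set (letters w) \<subseteq> S},
     mult = (*), one = 1, zero = 0, add = (+)\<rparr>"

text \<open>The algebra presented by the generators \<open>S\<close> and relations \<open>r = 0\<close> for \<open>r \<in> R\<close>, and the
  class in it of an element of the free algebra.\<close>

definition presented :: "gen set \<Rightarrow> falg set \<Rightarrow> falg set ring" where
  "presented S R = free_ring S Quot (genideal (free_ring S) R)"

definition cls :: "gen set \<Rightarrow> falg set \<Rightarrow> falg \<Rightarrow> falg set" where
  "cls S R x = genideal (free_ring S) R +>\<^bsub>free_ring S\<^esub> x"


section \<open>The reduced quantum group and its differential calculus\<close>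

definition mu :: "complex \<Rightarrow> complex" where
  "mu q = 1 - 1 / q^2"

definition A_gens :: "gen set" where
  "A_gens = {Gen_a, Gen_b, Gen_c, Gen_d}"

definition A_rels :: "complex \<Rightarrow> falg set" where
  "A_rels q =
    {gb * ga - scal q * ga * gb,
     gc * ga - scal q * ga * gc,
     gd * gb - scal q * gb * gd,
     gd * gc - scal q * gc * gd,
     gc * gb - gb * gc,
     gd * ga - ga * gd - scal (q * mu q) * gb * gc,
     ga * gd - scal (1 / q) * gb * gc - 1,
     ga^3 - 1, gd^3 - 1, gb^3, gc^3}"

definition Lambda_rels :: "complex \<Rightarrow> falg set" where
  "Lambda_rels q =
    {eb * eb, ec * ec, ed * ed,
     eb * ec + ec * eb, eb * ed + ed * eb, ec * ed + ed * ec,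
     ea * ea - scal (mu q) * eb * ec,
     ea * ed + ed * ea + scal (mu q) * eb * ec,
     ea * eb + scal (q^2) * eb * ea - scal (mu q) * eb * ed,
     ec * ea + scal (q^2) * ea * ec + scal (mu q) * ec * ed}"

definition cross_rels :: "complex \<Rightarrow> falg set" where
  "cross_rels q = (\<Union>(u, v) \<in> {(ga, gc), (gb, gd)}.
    {v * eb - eb * v,
     u * ec - ec * u,
     u * ed - scal (1 / q) * ed * u,
     v * ed - scal q * ed * v,
     u * eb - (eb * u + scal (q * mu q) * ed * v),
     v * ec - (ec * v + scal (q * mu q) * ed * u),
     v * ea - (scal (1 / q) * ea * v + scal (mu q) * eb * u),
     u * ea - (scal q * ea * u + scal (mu q) * ec * v + scal (q * (mu q)^2) * ed * u)})"

definition Omega_rels :: "complex \<Rightarrow> falg set" where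
  "Omega_rels q = A_rels q \<union> Lambda_rels q \<union> cross_rels q"

definition A_alg :: "complex \<Rightarrow> falg set ring" where
  "A_alg q = presented A_gens (A_rels q)"

definition A_cls :: "complex \<Rightarrow> falg \<Rightarrow> falg set" where
  "A_cls q = cls A_gens (A_rels q)"

definition A_scalars :: "complex \<Rightarrow> falg set set" where
  "A_scalars q = range (\<lambda>z. A_cls q (scal z))"

text \<open>The cross relations move every element of the coordinate algebra to the right of the
  generators \<open>e\<^sub>i\<close>; the tensor product algebra defined by them is the algebra generated by
  both factors subject to their own relations and the cross relations. The product of two forms
  is the wedge product.\<close>

definition Omega :: "complex \<Rightarrow> falg set ring" where
  "Omega q = presented UNIV (Omega_rels q)"

definition Omega_cls :: "complex \<Rightarrow> falg \<Rightarrow> falg set" where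
  "Omega_cls q = cls UNIV (Omega_rels q)"

text \<open>The canonical map from the coordinate algebra onto the 0-forms: it enlarges a coset of the
  smaller ideal to the coset of the larger one, see \<open>embed_A_cls\<close> below.\<close>

definition embed :: "complex \<Rightarrow> falg set \<Rightarrow> falg set" where
  "embed q X = genideal (free_ring UNIV) (Omega_rels q) <+>\<^bsub>free_ring UNIV\<^esub> X"

text \<open>The exterior derivative on forms of degree \<open>k\<close>; the degree is an integer so that the
  formula for the Laplacian makes sense in degree 0.\<close>

definition extd :: "complex \<Rightarrow> int \<Rightarrow> falg set \<Rightarrow> falg set" where
  "extd q k w = (let \<theta> = Omega_cls q (ea + ed) in
     \<ominus>\<^bsub>Omega q\<^esub> (if even k then \<theta> \<otimes>\<^bsub>Omega q\<^esub> w \<ominus>\<^bsub>Omega q\<^esub> w \<otimes>\<^bsub>Omega q\<^esub> \<theta>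
                  else \<theta> \<otimes>\<^bsub>Omega q\<^esub> w \<oplus>\<^bsub>Omega q\<^esub> w \<otimes>\<^bsub>Omega q\<^esub> \<theta>))"

definition hodge_table :: "complex \<Rightarrow> (falg \<times> falg) set" where
  "hodge_table q =
    {(1, ea * eb * ec * ed),
     (ea * eb * ec * ed, 1),
     (ea, - (ea * eb * ec) - scal (mu q) * eb * ec * ed),
     (eb, - (ea * eb * ed)),
     (ec, scal (q^2) * ea * ec * ed),
     (ed, eb * ec * ed),
     (ea * eb, - (ea * eb) + scal (2 * mu q) * eb * ed),
     (ea * ec, ea * ec),
     (ea * ed, scal (1 / (1 + q^2)) * (scal 2 * eb * ec - scal (q^2 * mu q) * ea * ed)),
     (eb * ec, scal (q^2 / (1 + q^2)) * (scal 2 * ea * ed + scal (mu q) * eb * ec)),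
     (eb * ed, eb * ed),
     (ec * ed, - (ec * ed)),
     (ea * eb * ec, - ea - scal (mu q) * ed),
     (ea * eb * ed, - eb),
     (ea * ec * ed, scal (1 / q^2) * ec),
     (eb * ec * ed, ed)}"

definition is_hodge :: "complex \<Rightarrow> (falg set \<Rightarrow> falg set) \<Rightarrow> bool" where
  "is_hodge q f \<longleftrightarrow>
     f \<in> carrier (Omega q) \<rightarrow>\<^sub>E carrier (Omega q) \<and>
     (\<forall>w \<in> carrier (Omega q). \<forall>w' \<in> carrier (Omega q).
        f (w \<oplus>\<^bsub>Omega q\<^esub> w') = f w \<oplus>\<^bsub>Omega q\<^esub> f w') \<and>
     (\<forall>w \<in> carrier (Omega q). \<forall>x \<in> carrier (A_alg q).
        f (w \<otimes>\<^bsub>Omega q\<^esub> embed q x) = f w \<otimes>\<^bsub>Omega q\<^esub> embed q x) \<and>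
     (\<forall>(e, s) \<in> hodge_table q. f (Omega_cls q e) = Omega_cls q s)"

text \<open>Extensionality in \<^const>\<open>is_hodge\<close> only pins the values outside the carrier, so that the
  right-linear map with the prescribed values on the basis is unique as a HOL function.\<close>

definition hodge :: "complex \<Rightarrow> falg set \<Rightarrow> falg set" where
  "hodge q = (THE f. is_hodge q f)"

definition codiff :: "complex \<Rightarrow> int \<Rightarrow> falg set \<Rightarrow> falg set" where
  "codiff q k w = hodge q (extd q (4 - k) (hodge q w))"

definition laplacian :: "complex \<Rightarrow> int \<Rightarrow> falg set \<Rightarrow> falg set" where
  "laplacian q k w =
     codiff q (k + 1) (extd q k w) \<oplus>\<^bsub>Omega q\<^esub> extd q (k - 1) (codiff q k w)"

definition harmonic0 :: "complex \<Rightarrow> falg set set" where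
  "harmonic0 q = {x \<in> carrier (A_alg q). laplacian q 0 (embed q x) = \<zero>\<^bsub>Omega q\<^esub>}"


section \<open>Well-definedness\<close>

lemma keys_free_mult:
  fixes p r :: falg
  assumes "\<forall>w \<in> Poly_Mapping.keys p. set (letters w) \<subseteq> S"
    and "\<forall>w \<in> Poly_Mapping.keys r. set (letters w) \<subseteq> S"
  shows "\<forall>w \<in> Poly_Mapping.keys (p * r). set (letters w) \<subseteq> S"
proof
  fix w assume "w \<in> Poly_Mapping.keys (p * r)"
  then obtain u v where "w = u + v" "u \<in> Poly_Mapping.keys p" "v \<in> Poly_Mapping.keys r"
    using keys_mult[of p r] by blast
  with assms show "set (letters w) \<subseteq> S" by (simp add: plus_word_def)
qed

lemma ring_free_ring: "ring (free_ring S)"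
proof (rule ringI)
  show "abelian_group (free_ring S)"
  proof (rule abelian_groupI)
    fix x y assume "x \<in> carrier (free_ring S)" "y \<in> carrier (free_ring S)"
    then show "x \<oplus>\<^bsub>free_ring S\<^esub> y \<in> carrier (free_ring S)"
      using Poly_Mapping.keys_add[of x y] by (auto simp: free_ring_def)
  next
    fix x assume "x \<in> carrier (free_ring S)"
    then show "\<exists>y\<in>carrier (free_ring S). y \<oplus>\<^bsub>free_ring S\<^esub> x = \<zero>\<^bsub>free_ring S\<^esub>"
      by (intro bexI[of _ "- x"]) (auto simp: free_ring_def)
  qed (auto simp: free_ring_def algebra_simps)
next
  show "Group.monoid (free_ring S)"
  proof (rule monoidI)
    fix x y assume "x \<in> carrier (free_ring S)" "y \<in> carrier (free_ring S)"
    then show "x \<otimes>\<^bsub>free_ring S\<^esub> y \<in> carrier (free_ring S)"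
      using keys_free_mult[of x S y] by (auto simp: free_ring_def)
  qed (auto simp: free_ring_def algebra_simps zero_word_def)
qed (auto simp: free_ring_def algebra_simps)

lemma gen_in_free_ring: "g \<in> S \<Longrightarrow> gen g \<in> carrier (free_ring S)"
  by (auto simp: free_ring_def gen_def)

lemma scal_in_free_ring: "scal z \<in> carrier (free_ring S)"
  by (auto simp: free_ring_def scal_def zero_word_def)

lemma add_in_free_ring:
  "x \<in> carrier (free_ring S) \<Longrightarrow> y \<in> carrier (free_ring S) \<Longrightarrow> x + y \<in> carrier (free_ring S)"
  using abelian_groupE(1)[OF ring.is_abelian_group[OF ring_free_ring], of x S y]
  by (simp add: free_ring_def)

lemma uminus_in_free_ring:
  "x \<in> carrier (free_ring S) \<Longrightarrow> - x \<in> carrier (free_ring S)"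
  by (auto simp: free_ring_def)

lemma diff_in_free_ring:
  "x \<in> carrier (free_ring S) \<Longrightarrow> y \<in> carrier (free_ring S) \<Longrightarrow> x - y \<in> carrier (free_ring S)"
  using add_in_free_ring[of x S "- y"] uminus_in_free_ring[of y S] by simp

lemma mult_in_free_ring:
  "x \<in> carrier (free_ring S) \<Longrightarrow> y \<in> carrier (free_ring S) \<Longrightarrow> x * y \<in> carrier (free_ring S)"
  using keys_free_mult[of x S y] by (auto simp: free_ring_def)

lemma one_in_free_ring: "1 \<in> carrier (free_ring S)"
  by (auto simp: free_ring_def zero_word_def)

lemma power_in_free_ring:
  "x \<in> carrier (free_ring S) \<Longrightarrow> x ^ n \<in> carrier (free_ring S)"
  by (induction n) (auto intro: one_in_free_ring mult_in_free_ring)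

lemmas free_ring_closed = gen_in_free_ring scal_in_free_ring add_in_free_ring
  uminus_in_free_ring diff_in_free_ring mult_in_free_ring one_in_free_ring power_in_free_ring

lemma A_rels_carrier: "A_rels q \<subseteq> carrier (free_ring A_gens)"
  unfolding A_rels_def by (auto intro!: free_ring_closed simp: A_gens_def)

lemma Omega_rels_carrier: "Omega_rels q \<subseteq> carrier (free_ring UNIV)"
  by (auto simp: free_ring_def)

lemma ideal_A: "ideal (genideal (free_ring A_gens) (A_rels q)) (free_ring A_gens)"
  by (rule ring.genideal_ideal[OF ring_free_ring A_rels_carrier])

lemma ideal_Omega: "ideal (genideal (free_ring UNIV) (Omega_rels q)) (free_ring UNIV)"
  by (rule ring.genideal_ideal[OF ring_free_ring Omega_rels_carrier])

lemma ring_A_alg: "ring (A_alg q)"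
  unfolding A_alg_def presented_def by (rule ideal.quotient_is_ring[OF ideal_A])

lemma ring_Omega: "ring (Omega q)"
  unfolding Omega_def presented_def by (rule ideal.quotient_is_ring[OF ideal_Omega])

lemma A_ideal_subset:
  "genideal (free_ring A_gens) (A_rels q) \<subseteq> genideal (free_ring UNIV) (Omega_rels q)"
proof -
  let ?F = "free_ring A_gens" and ?G = "free_ring UNIV"
  let ?J = "genideal ?G (Omega_rels q)"
  interpret F: ring ?F by (rule ring_free_ring)
  interpret J: ideal ?J ?G by (rule ideal_Omega)
  have plus: "x \<oplus>\<^bsub>?G\<^esub> y = x + y" for x y by (simp add: free_ring_def)
  have Jadd: "x + y \<in> ?J" if "x \<in> ?J" "y \<in> ?J" for x y
    using additive_subgroup.a_closed[OF J.is_additive_subgroup that] by (simp only: plus)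
  have minus: "- x \<in> ?J" if "x \<in> ?J" for x
  proof -
    have "- 1 * x \<in> ?J"
      using J.I_l_closed[of x "- 1"] that by (simp add: free_ring_def)
    then show ?thesis by simp
  qed
  have finv: "inv\<^bsub>add_monoid ?F\<^esub> x = - x" if "x \<in> carrier ?F" for x
    using F.minus_equality[of "- x" x] that uminus_in_free_ring[OF that]
    by (simp add: free_ring_def a_inv_def)
  have "ideal (?J \<inter> carrier ?F) ?F"
  proof (rule idealI)
    show "subgroup (?J \<inter> carrier ?F) (add_monoid ?F)"
    proof
      fix x y assume "x \<in> ?J \<inter> carrier ?F" "y \<in> ?J \<inter> carrier ?F"
      then show "x \<otimes>\<^bsub>add_monoid ?F\<^esub> y \<in> ?J \<inter> carrier ?F"
        using Jadd[of x y] add_in_free_ring[of x A_gens y] by (simp add: free_ring_def)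
    next
      show "\<one>\<^bsub>add_monoid ?F\<^esub> \<in> ?J \<inter> carrier ?F"
        using additive_subgroup.zero_closed[OF J.is_additive_subgroup] by (simp add: free_ring_def)
    next
      fix x assume "x \<in> ?J \<inter> carrier ?F"
      then show "inv\<^bsub>add_monoid ?F\<^esub> x \<in> ?J \<inter> carrier ?F"
        using minus[of x] uminus_in_free_ring[of x] finv[of x] by simp
    qed simp
  next
    fix x y assume "x \<in> ?J \<inter> carrier ?F" "y \<in> carrier ?F"
    then show "y \<otimes>\<^bsub>?F\<^esub> x \<in> ?J \<inter> carrier ?F" "x \<otimes>\<^bsub>?F\<^esub> y \<in> ?J \<inter> carrier ?F"
      using J.I_l_closed[of x y] J.I_r_closed[of x y]
        mult_in_free_ring[of x A_gens y] mult_in_free_ring[of y A_gens x]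
      by (simp_all add: free_ring_def)
  qed (rule ring_free_ring)
  moreover have "A_rels q \<subseteq> ?J \<inter> carrier ?F"
    using ring.genideal_self[OF ring_free_ring Omega_rels_carrier] A_rels_carrier
    by (auto simp: Omega_rels_def)
  ultimately show ?thesis
    using ring.genideal_minimal[OF ring_free_ring] by blast
qed

lemma embed_A_cls:
  assumes "x \<in> carrier (free_ring A_gens)"
  shows "embed q (A_cls q x) = Omega_cls q x"
proof -
  let ?I = "genideal (free_ring A_gens) (A_rels q)"
  let ?J = "genideal (free_ring UNIV) (Omega_rels q)"
  interpret J: ideal ?J "free_ring UNIV" by (rule ideal_Omega)
  interpret I: ideal ?I "free_ring A_gens" by (rule ideal_A)
  have plus: "x \<oplus>\<^bsub>free_ring UNIV\<^esub> y = x + y" for x y by (simp add: free_ring_def)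
  have "h + i \<in> ?J" if "h \<in> ?J" "i \<in> ?I" for h i
    using additive_subgroup.a_closed[OF J.is_additive_subgroup that(1), of i] that(2)
      A_ideal_subset[of q] by (simp only: plus subset_iff)
  moreover have "0 \<in> ?I" using additive_subgroup.zero_closed[OF I.is_additive_subgroup] by (simp add: free_ring_def)
  ultimately show ?thesis
    unfolding embed_def A_cls_def Omega_cls_def cls_def
    by (auto simp: set_add_def' a_r_coset_def' free_ring_def)
qed

end

theory Submission
  imports Defs
begin

text \<open>
  The coordinate algebra \<open>A\<close> acts on the functions on monomial exponents \<open>(m, n, k)\<close> by left
  multiplication on \<open>a\<^sup>m b\<^sup>n c\<^sup>k\<close>. The cross relations make the forms a smash product: \<open>\<Lambda>\<close> is an
  \<open>A\<close>-module algebra and \<open>a e = (a \<triangleright> e) a + (b \<triangleright> e) c\<close>, and so on along the coproduct. Hence the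
  algebra of forms acts on \<open>\<Lambda> \<otimes> A\<close>; evaluating at \<open>1 \<otimes> 1\<close> separates the normal forms
  \<open>e\<^sub>I a\<^sup>m b\<^sup>n c\<^sup>k\<close>, which span by rewriting. So the forms are free over \<open>A\<close>, the Hodge operator
  exists and is unique, and every identity of forms can be checked in coordinates.

  Write \<open>x \<theta> = \<Sum> e\<^sub>i \<tau>\<^sub>i(x)\<close> for a function \<open>x\<close>, so that \<open>d x = \<Sum> e\<^sub>i \<partial>\<^sub>i(x)\<close> with
  \<open>\<partial>\<^sub>i = \<tau>\<^sub>i - \<theta>\<^sub>i\<close>. The operators \<open>\<tau>\<^sub>i\<close> are weighted shifts of the exponents, the Laplacian is a
  quadratic form in the \<open>\<partial>\<^sub>i\<close>, and it comes out as a diagonal plus a shift by \<open>b c\<close>.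
\<close>

section \<open>Linear operators and evaluation of the free algebra\<close>

text \<open>Both algebras are quotients of a free algebra by generated ideals, so neither the
  dimension 27 nor freeness of the forms comes with the definitions. Rewriting shows only that the
  normal forms span; that something lies outside the ideal needs a model killing all relations. The
  delicate relations of the model are the cubes of \<open>a\<close>, \<open>b\<close>,
  \<open>c\<close>, \<open>d\<close> on the tensor product: they follow from the coproduct, because
  the q-binomial coefficients in the third power of a sum vanish when \<open>q ^ 3 = 1\<close>. The
  map taking x to x times theta commutes with left multiplication by functions, so it is determined
  by its value at 1. Hence closed formulas for the four shifts need only be compared with the cross
  relations and with theta itself. All scalars reduce to the form x + q y by
  \<open>q * q = - 1 - q\<close>, so finite checks are left to the simplifier. In the kernel
  equation 14 of the 27 coordinates are eliminated by back substitution; the 13 free ones are the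
  pivots of the given basis.\<close>

typedef 'i linop = "{F :: ('i \<Rightarrow> complex) \<Rightarrow> ('i \<Rightarrow> complex).
    (\<forall>f g. F (\<lambda>i. f i + g i) = (\<lambda>i. F f i + F g i)) \<and> (\<forall>c f. F (\<lambda>i. c * f i) = (\<lambda>i. c * F f i))}"
  morphisms app Linop
  by (rule exI[of _ "\<lambda>f. f"]) simp

setup_lifting type_definition_linop

lemma app_add: "app X (\<lambda>i. f i + g i) = (\<lambda>i. app X f i + app X g i)"
  using app[of X] by blast

lemma app_mult: "app X (\<lambda>i. c * f i) = (\<lambda>i. c * app X f i)"
  using app[of X] by blast

lemma app_zero: "app X (\<lambda>i. 0) = (\<lambda>i. 0)"
  using app_mult[of X 0 "\<lambda>i. 0"] by simp

lemma app_sum: "app X (\<lambda>i. \<Sum>s\<in>S. f s i) = (\<lambda>i. \<Sum>s\<in>S. app X (f s) i)"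
  by (induction S rule: infinite_finite_induct) (simp_all add: app_zero app_add)

lemma linop_eqI: "(\<And>f i. app X f i = app Y f i) \<Longrightarrow> X = Y"
  by (metis app_inject ext)

text \<open>With this instance \<open>algebra_simps\<close> and powers apply to noncommuting
  operators.\<close>

instantiation linop :: (type) ring_1
begin
lift_definition zero_linop :: "'a linop" is "\<lambda>f i. 0" by simp
lift_definition one_linop :: "'a linop" is "\<lambda>f. f" by simp
lift_definition plus_linop :: "'a linop \<Rightarrow> 'a linop \<Rightarrow> 'a linop" is "\<lambda>X Y f i. X f i + Y f i"
  by (simp add: algebra_simps)
lift_definition uminus_linop :: "'a linop \<Rightarrow> 'a linop" is "\<lambda>X f i. - X f i" by simp
lift_definition minus_linop :: "'a linop \<Rightarrow> 'a linop \<Rightarrow> 'a linop" is "\<lambda>X Y f i. X f i - Y f i"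
  by (simp add: algebra_simps)
lift_definition times_linop :: "'a linop \<Rightarrow> 'a linop \<Rightarrow> 'a linop" is "\<lambda>X Y f. X (Y f)" by simp
instance
proof
  show "(0::'a linop) \<noteq> 1"
    by transfer (metis zero_neq_one)
  show "X * (Y + Z) = X * Y + X * Z" for X Y Z :: "'a linop"
    by transfer blast
qed (transfer; simp add: algebra_simps)+
end

lemma app_simps [simp]:
  "app 0 f i = 0" "app 1 f = f" "app (X + Y) f i = app X f i + app Y f i"
  "app (- X) f i = - app X f i" "app (X - Y) f i = app X f i - app Y f i"
  "app (X * Y) f = app X (app Y f)"
  by (transfer; simp)+

lift_definition sc :: "complex \<Rightarrow> 'i linop" is "\<lambda>z f i. z * f i"
  by (simp add: algebra_simps)

lemma app_sc [simp]: "app (sc z) f i = z * f i"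
  by transfer simp

lemma sc_commute: "X * sc z = sc z * X"
proof (rule linop_eqI)
  fix f i
  have "app (sc z) f = (\<lambda>i. z * f i)" for f :: "'a \<Rightarrow> complex" by (rule ext) simp
  then show "app (X * sc z) f i = app (sc z * X) f i" by (simp add: app_mult)
qed

lemma sc_simps: "sc 0 = 0" "sc 1 = 1" "sc (z + w) = sc z + sc w" "sc (z - w) = sc z - sc w"
  "sc (- z) = - sc z" "sc (z * w) = sc z * sc w"
  by (rule linop_eqI; simp add: algebra_simps)+

definition ev :: "(gen \<Rightarrow> 'i linop) \<Rightarrow> falg \<Rightarrow> 'i linop" where
  "ev \<phi> p = (\<Sum>w\<in>Poly_Mapping.keys p. sc (Poly_Mapping.lookup p w) * prod_list (map \<phi> (letters w)))"

lemma ev_superset: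
  assumes "finite K" "Poly_Mapping.keys p \<subseteq> K"
  shows "ev \<phi> p = (\<Sum>w\<in>K. sc (Poly_Mapping.lookup p w) * prod_list (map \<phi> (letters w)))"
  unfolding ev_def using assms
  by (intro sum.mono_neutral_left) (auto simp: sc_simps not_in_keys_iff_lookup_eq_zero)

lemma ev_add: "ev \<phi> (p + r) = ev \<phi> p + ev \<phi> r"
proof -
  let ?K = "Poly_Mapping.keys p \<union> Poly_Mapping.keys r"
  have "Poly_Mapping.keys (p + r) \<subseteq> ?K" by (rule keys_add)
  then show ?thesis
    by (simp add: ev_superset[of ?K] lookup_add sc_simps distrib_right sum.distrib)
qed

lemma ev_single: "ev \<phi> (Poly_Mapping.single w z) = sc z * prod_list (map \<phi> (letters w))"
  by (cases "z = 0") (simp_all add: ev_def sc_simps)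

lemma ev_zero [simp]: "ev \<phi> 0 = 0"
  by (simp add: ev_def)

lemma ev_sum: "ev \<phi> (\<Sum>i\<in>K. p i) = (\<Sum>i\<in>K. ev \<phi> (p i))"
  by (induction K rule: infinite_finite_induct) (simp_all add: ev_add)

lemma ev_uminus: "ev \<phi> (- p) = - ev \<phi> p"
  using ev_add[of \<phi> p "- p"] by (simp add: minus_unique)

lemma ev_diff: "ev \<phi> (p - r) = ev \<phi> p - ev \<phi> r"
  using ev_add[of \<phi> p "- r"] by (simp add: ev_uminus)

lemma single_sum_keys:
  fixes p :: falg
  shows "p = (\<Sum>w\<in>Poly_Mapping.keys p. Poly_Mapping.single w (Poly_Mapping.lookup p w))"
  by (rule poly_mapping_eqI)
    (simp add: lookup_sum lookup_single when_def sum.delta in_keys_iff)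

lemma single_word:
  "Poly_Mapping.single (Word []) z = scal z"
  "Poly_Mapping.single (Word (g # l)) z = gen g * Poly_Mapping.single (Word l) z"
  by (simp_all add: scal_def gen_def zero_word_def mult_single plus_word_def)

text \<open>Words are peeled from the left, which suits both the left actions and the rewriting: a
  property only has to survive left multiplication by one generator.\<close>

lemma free_ring_induct [consumes 1, case_names add scal gen]:
  assumes "x \<in> carrier (free_ring S)"
    and add: "\<And>x y. x \<in> carrier (free_ring S) \<Longrightarrow> y \<in> carrier (free_ring S) \<Longrightarrow> P x \<Longrightarrow> P y \<Longrightarrow> P (x + y)"
    and scal: "\<And>z. P (scal z)"
    and gen: "\<And>g x. g \<in> S \<Longrightarrow> x \<in> carrier (free_ring S) \<Longrightarrow> P x \<Longrightarrow> P (gen g * x)"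
  shows "P x"
proof -
  have single: "Poly_Mapping.single (Word l) z \<in> carrier (free_ring S) \<and> P (Poly_Mapping.single (Word l) z)"
    if "set l \<subseteq> S" for l z
    using that
  proof (induction l)
    case Nil
    show ?case unfolding single_word using scal scal_in_free_ring by blast
  next
    case (Cons g l)
    then show ?case unfolding single_word
      using gen mult_in_free_ring[OF gen_in_free_ring[of g S]] by simp
  qed
  have "(\<Sum>w\<in>K. Poly_Mapping.single w (Poly_Mapping.lookup x w)) \<in> carrier (free_ring S) \<and>
      P (\<Sum>w\<in>K. Poly_Mapping.single w (Poly_Mapping.lookup x w))"
    if "K \<subseteq> Poly_Mapping.keys x" for K
  proof -
    have "finite K" using that by (rule finite_subset) simp
    then show ?thesis using that
    proof induction
      case empty
      have "scal 0 = 0" by (simp add: scal_def)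
      then show ?case using scal[of 0] scal_in_free_ring[of 0 S] unfolding sum.empty by simp
    next
      case (insert w K)
      have "w \<in> Poly_Mapping.keys x" using insert.prems by blast
      with assms(1) have "set (letters w) \<subseteq> S" unfolding free_ring_def partial_object.simps by blast
      then have w: "Poly_Mapping.single w (Poly_Mapping.lookup x w) \<in> carrier (free_ring S) \<and>
          P (Poly_Mapping.single w (Poly_Mapping.lookup x w))"
        using single[of "letters w"] by (metis word.collapse)
      have K: "K \<subseteq> Poly_Mapping.keys x" using insert.prems by simp
      note IH = insert.IH[OF K]
      show ?case
        unfolding sum.insert[OF insert.hyps]
        by (rule conjI add_in_free_ring add conjunct1[OF w] conjunct2[OF w] conjunct1[OF IH] conjunct2[OF IH])+
    qed
  qed
  from conjunct2[OF this[OF subset_refl]] show ?thesis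
    unfolding single_sum_keys[of x, symmetric] .
qed

lemma UNIV_free_ring [simp]: "p \<in> carrier (free_ring UNIV)"
  by (simp add: free_ring_def)

lemma scal_simps: "scal 0 = 0" "scal 1 = 1" "scal (z + w) = scal z + scal w"
  "scal (z - w) = scal z - scal w" "scal (- z) = - scal z" "scal (z * w) = scal z * scal w"
  by (simp_all add: scal_def single_add single_diff single_uminus mult_single)

lemma ev_gen: "ev \<phi> (gen g) = \<phi> g"
  by (simp add: gen_def ev_single sc_simps)

lemma ev_scal: "ev \<phi> (scal z) = sc z"
  by (simp add: scal_def ev_single zero_word_def)

lemma ev_one [simp]: "ev \<phi> 1 = 1"
  using ev_scal[of \<phi> 1] by (simp add: scal_simps sc_simps)

lemma scal_mult_single: "scal z * Poly_Mapping.single w c = Poly_Mapping.single w (z * c)"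
  by (simp add: scal_def mult_single)

lemma single_mult_scal: "Poly_Mapping.single w c * scal z = Poly_Mapping.single w (c * z)"
  by (simp add: scal_def mult_single)

lemma scal_commute: "x * scal z = scal z * x"
proof -
  have "x \<in> carrier (free_ring UNIV)" by simp
  then show ?thesis
  proof (induction x rule: free_ring_induct)
    case (scal w)
    then show ?case by (simp add: mult.commute flip: scal_simps)
  next
    case (gen g x)
    have "gen g * scal z = scal z * gen g" by (simp add: gen_def scal_mult_single single_mult_scal)
    with gen show ?case by (metis mult.assoc)
  qed (simp add: distrib_left distrib_right)
qed

lemma ev_scal_mult: "ev \<phi> (scal z * x) = sc z * ev \<phi> x"
proof -
  have "ev \<phi> (scal z * (\<Sum>w\<in>K. Poly_Mapping.single w (f w))) =
      sc z * ev \<phi> (\<Sum>w\<in>K. Poly_Mapping.single w (f w))" for K f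
    by (simp add: sum_distrib_left ev_sum scal_mult_single ev_single sc_simps mult.assoc)
  from this[of "Poly_Mapping.lookup x" "Poly_Mapping.keys x"] show ?thesis
    unfolding single_sum_keys[of x, symmetric] .
qed

lemma ev_gen_mult: "ev \<phi> (gen g * x) = \<phi> g * ev \<phi> x"
proof -
  have "ev \<phi> (gen g * Poly_Mapping.single w c) = \<phi> g * ev \<phi> (Poly_Mapping.single w c)" for w c
    using sc_commute[of "\<phi> g" c]
    by (simp add: gen_def mult_single plus_word_def ev_single) (metis mult.assoc)
  then have "ev \<phi> (gen g * (\<Sum>w\<in>K. Poly_Mapping.single w (f w))) =
      \<phi> g * ev \<phi> (\<Sum>w\<in>K. Poly_Mapping.single w (f w))" for K f
    by (simp add: sum_distrib_left ev_sum)
  from this[of "Poly_Mapping.lookup x" "Poly_Mapping.keys x"] show ?thesis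
    unfolding single_sum_keys[of x, symmetric] .
qed

lemma ev_mult: "ev \<phi> (p * r) = ev \<phi> p * ev \<phi> r"
proof -
  have "p \<in> carrier (free_ring UNIV)" by simp
  then show ?thesis
    by (induction p rule: free_ring_induct)
      (simp_all add: ev_add ev_gen_mult ev_scal_mult ev_scal distrib_right mult.assoc)
qed

lemma ev_power: "ev \<phi> (p ^ n) = ev \<phi> p ^ n"
  by (induction n) (simp_all add: ev_mult)

lemmas ev_simps = ev_add ev_diff ev_uminus ev_mult ev_power ev_gen ev_scal ev_zero ev_one

section \<open>Presented algebras\<close>

locale presentation =
  fixes S :: "gen set" and R :: "falg set"
  assumes rels: "R \<subseteq> carrier (free_ring S)"
begin

abbreviation F where "F \<equiv> free_ring S"
abbreviation J where "J \<equiv> genideal F R"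
abbreviation P where "P \<equiv> presented S R"
abbreviation cl where "cl \<equiv> cls S R"

interpretation F: ring F by (rule ring_free_ring)
interpretation J: ideal J F by (rule F.genideal_ideal[OF rels])
interpretation P: ring P unfolding presented_def by (rule J.quotient_is_ring)

lemma F_simps: "x \<otimes>\<^bsub>F\<^esub> y = x * y" "x \<oplus>\<^bsub>F\<^esub> y = x + y" "\<zero>\<^bsub>F\<^esub> = 0" "\<one>\<^bsub>F\<^esub> = 1"
  by (simp_all add: free_ring_def)

lemma F_minus: "x \<in> carrier F \<Longrightarrow> \<ominus>\<^bsub>F\<^esub> x = - x"
  using F.minus_equality[of "- x" x] uminus_in_free_ring[of x S] by (simp add: F_simps)

lemma F_diff: "x \<in> carrier F \<Longrightarrow> y \<in> carrier F \<Longrightarrow> x \<ominus>\<^bsub>F\<^esub> y = x - y"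
  by (simp add: a_minus_def F_minus F_simps)

lemma J_carrier: "x \<in> J \<Longrightarrow> x \<in> carrier F"
  by (rule J.a_Hcarr)

lemma J_rel: "x \<in> R \<Longrightarrow> x \<in> J"
  using F.genideal_self[OF rels] by blast

lemma J_zero: "0 \<in> J"
  using additive_subgroup.zero_closed[OF J.is_additive_subgroup] by (simp add: F_simps)

lemma J_add: "x \<in> J \<Longrightarrow> y \<in> J \<Longrightarrow> x + y \<in> J"
  using additive_subgroup.a_closed[OF J.is_additive_subgroup, of x y] by (simp add: F_simps)

lemma J_mult_left: "x \<in> J \<Longrightarrow> y \<in> carrier F \<Longrightarrow> y * x \<in> J"
  using J.I_l_closed[of x y] by (simp add: F_simps)

lemma J_mult_right: "x \<in> J \<Longrightarrow> y \<in> carrier F \<Longrightarrow> x * y \<in> J"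
  using J.I_r_closed[of x y] by (simp add: F_simps)

lemma J_scal: "x \<in> J \<Longrightarrow> scal z * x \<in> J"
  by (rule J_mult_left[OF _ scal_in_free_ring])

lemma J_uminus: "x \<in> J \<Longrightarrow> - x \<in> J"
  using J_scal[of x "- 1"] by (simp add: scal_simps)

lemma J_diff: "x \<in> J \<Longrightarrow> y \<in> J \<Longrightarrow> x - y \<in> J"
  using J_add[of x "- y"] J_uminus[of y] by simp

lemma J_sum: "(\<And>i. i \<in> K \<Longrightarrow> f i \<in> J) \<Longrightarrow> sum f K \<in> J"
  by (induction K rule: infinite_finite_induct) (auto simp: J_zero intro: J_add)

lemma cl_eq_iff:
  assumes "x \<in> carrier F" "y \<in> carrier F"
  shows "cl x = cl y \<longleftrightarrow> x - y \<in> J"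
  using F.quotient_eq_iff_same_a_r_cos[OF J.ideal_axioms assms]
  by (simp add: cls_def F_diff assms)

lemma carrier_P: "carrier P = cl ` carrier F"
  by (auto simp: presented_def FactRing_def A_RCOSETS_def' cls_def a_r_coset_def')

lemma cl_hom: "cl \<in> ring_hom F P"
  using J.rcos_ring_hom unfolding presented_def cls_def by (simp add: ring_hom_def)

interpretation cl: ring_hom_ring F P cl
  by (rule ring_hom_ringI2[OF F.ring_axioms P.ring_axioms cl_hom])

lemma cl_add: "x \<in> carrier F \<Longrightarrow> y \<in> carrier F \<Longrightarrow> cl (x + y) = cl x \<oplus>\<^bsub>P\<^esub> cl y"
  using cl.hom_add by (simp add: F_simps)

lemma cl_mult: "x \<in> carrier F \<Longrightarrow> y \<in> carrier F \<Longrightarrow> cl (x * y) = cl x \<otimes>\<^bsub>P\<^esub> cl y"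
  using cl.hom_mult by (simp add: F_simps)

lemma cl_uminus: "x \<in> carrier F \<Longrightarrow> cl (- x) = \<ominus>\<^bsub>P\<^esub> cl x"
  using cl.hom_a_inv[of x] by (simp add: F_minus)

lemma cl_diff: "x \<in> carrier F \<Longrightarrow> y \<in> carrier F \<Longrightarrow> cl (x - y) = cl x \<ominus>\<^bsub>P\<^esub> cl y"
  using cl_add[of x "- y"] by (simp add: cl_uminus uminus_in_free_ring a_minus_def)

lemma cl_zero: "cl 0 = \<zero>\<^bsub>P\<^esub>"
  using cl.hom_zero by (simp add: F_simps)

lemma cl_eq_zero_iff: "x \<in> carrier F \<Longrightarrow> cl x = \<zero>\<^bsub>P\<^esub> \<longleftrightarrow> x \<in> J"
  using cl_eq_iff[of x 0] F.zero_closed by (simp add: F_simps flip: cl_zero)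

text \<open>The elements killed by \<open>ev\<close> form an ideal, and \<open>genideal\<close> is
  the least ideal containing the relations. So a nonzero value certifies that an element is outside
  \<open>J\<close>.\<close>

lemma ev_J:
  assumes "\<And>r. r \<in> R \<Longrightarrow> ev \<phi> r = 0" "x \<in> J"
  shows "ev \<phi> x = 0"
proof -
  let ?N = "{x \<in> carrier F. ev \<phi> x = 0}"
  have "ideal ?N F"
  proof (rule idealI)
    show "subgroup ?N (add_monoid F)"
    proof
      fix x assume "x \<in> ?N"
      then show "inv\<^bsub>add_monoid F\<^esub> x \<in> ?N"
        using F_minus[of x] by (simp add: a_inv_def ev_uminus uminus_in_free_ring)
    qed (use F.zero_closed in \<open>auto simp: F_simps ev_add add_in_free_ring\<close>)
  qed (auto simp: F_simps ev_mult mult_in_free_ring F.ring_axioms)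
  then have "J \<subseteq> ?N"
    using F.genideal_minimal[of ?N R] rels assms(1) by blast
  then show ?thesis using assms(2) by blast
qed

lemma line_extension_cl:
  "cl x \<in> ring.line_extension P ((\<lambda>z. cl (scal z)) ` UNIV) (cl u) (cl ` E) \<longleftrightarrow>
    (\<exists>z. \<exists>v\<in>E. x - (scal z * u + v) \<in> J)"
  if "x \<in> carrier F" "u \<in> carrier F" "E \<subseteq> carrier F"
proof -
  have "cl x = cl (scal z) \<otimes>\<^bsub>P\<^esub> cl u \<oplus>\<^bsub>P\<^esub> cl v \<longleftrightarrow> x - (scal z * u + v) \<in> J" if "v \<in> E" for z v
  proof -
    have v: "v \<in> carrier F" using that \<open>E \<subseteq> carrier F\<close> by blast
    have zu: "scal z * u \<in> carrier F" by (intro free_ring_closed \<open>u \<in> carrier F\<close>)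
    show ?thesis
      using cl_eq_iff[OF \<open>x \<in> carrier F\<close> add_in_free_ring[OF zu v]]
      by (simp add: cl_add[OF zu v] cl_mult[OF scal_in_free_ring \<open>u \<in> carrier F\<close>])
  qed
  then show ?thesis
    by (auto simp: P.line_extension_mem_iff)
qed

end

interpretation A: presentation A_gens "A_rels q" for q
  by standard (rule A_rels_carrier)

interpretation O: presentation UNIV "Omega_rels q" for q
  by standard (rule Omega_rels_carrier)

section \<open>Operators on \<open>\<Lambda> \<otimes> A\<close>\<close>

lift_definition wshift :: "('j \<Rightarrow> complex) \<Rightarrow> ('j \<Rightarrow> 'j) \<Rightarrow> 'j linop" is "\<lambda>w s f j. w j * f (s j)"
  by (simp add: algebra_simps)

text \<open>The first component of an index is the position of a basis form in \<open>ebas\<close> below. An entry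
  \<open>(r, s, c)\<close> contributes \<open>c e\<^sub>r\<close> to the image of \<open>e\<^sub>s\<close>. Indices outside the \<open>16 \<times> 27\<close> basis are
  junk, on which the relations have to hold as well: \<open>tab\<close> vanishes there, whereas \<open>opA\<close>, \<open>act_a\<close>
  and \<open>act_d\<close> have to be invertible there too.\<close>

lift_definition tab :: "(nat \<times> nat \<times> complex) list \<Rightarrow> (nat \<times> 'j) linop" is
  "\<lambda>T f (i, j). \<Sum>(r, s, c)\<leftarrow>T. if i = r then c * f (s, j) else 0"
proof -
  fix T :: "(nat \<times> nat \<times> complex) list"
  show "(\<forall>f g. (\<lambda>(i, j). \<Sum>(r, s, c)\<leftarrow>T. if i = r then c * (f (s, j) + g (s, j)) else 0) =
       (\<lambda>i. (case i of (i, j) \<Rightarrow> \<Sum>(r, s, c)\<leftarrow>T. if i = r then c * f (s, j) else 0) +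
             (case i of (i, j) \<Rightarrow> \<Sum>(r, s, c)\<leftarrow>T. if i = r then c * g (s, j) else 0))) \<and>
      (\<forall>d f. (\<lambda>(i, j). \<Sum>(r, s, c)\<leftarrow>T. if i = r then c * (d * f (s, j)) else 0) =
       (\<lambda>i. d * (case i of (i, j) \<Rightarrow> \<Sum>(r, s, c)\<leftarrow>T. if i = r then c * f (s, j) else 0)))"
    by (induction T) (auto simp: fun_eq_iff algebra_simps)
qed

lift_definition rgt :: "'j linop \<Rightarrow> (nat \<times> 'j) linop" is "\<lambda>X f (i, j). X (\<lambda>j'. f (i, j')) j"
  by (auto simp: fun_eq_iff)

lemma app_wshift [simp]: "app (wshift w s) f j = w j * f (s j)"
  by transfer simp

lemma app_tab [simp]:
  "app (tab []) f p = 0"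
  "app (tab ((r, s, c) # T)) f (i, j) = (if i = r then c * f (s, j) else 0) + app (tab T) f (i, j)"
  by (transfer; auto)+

lemma app_rgt [simp]: "app (rgt X) f (i, j) = app X (\<lambda>j'. f (i, j')) j"
  by transfer simp

lemma rgt_simps: "rgt (X + Y) = rgt X + rgt Y" "rgt (X - Y) = rgt X - rgt Y" "rgt (- X) = - rgt X"
  "rgt (X * Y) = rgt X * rgt Y" "rgt 0 = 0" "rgt 1 = 1" "rgt (sc z) = sc z"
  by (rule linop_eqI; clarsimp)+

text \<open>\<open>tab\<close> mixes only the form index and \<open>rgt\<close> only the monomial
  index: they act on different tensor factors.\<close>

lemma rgt_tab: "rgt X * tab T = tab T * rgt X"
proof -
  have "app (rgt X) (app (tab T) f) (i, j) = app (tab T) (app (rgt X) f) (i, j)" for f i j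
  proof (induction T)
    case Nil
    show ?case by (simp add: app_zero)
  next
    case (Cons e T)
    obtain r s c where e: "e = (r, s, c)" using prod_cases3 by blast
    then show ?case
      using Cons by (cases "i = r") (simp_all add: app_add app_mult)
  qed
  then show ?thesis by (intro linop_eqI) auto
qed

text \<open>This is m - 1 modulo 3, the source exponent for multiplication by \<open>a\<close>. It
  fixes junk exponents, so its third iterate is the identity everywhere.\<close>

definition rot :: "nat \<Rightarrow> nat" where
  "rot m = (if m = 0 then 2 else if m < 3 then m - 1 else m)"

type_synonym mono = "nat \<times> nat \<times> nat"

definition opA :: "mono linop" where
  "opA = wshift (\<lambda>_. 1) (\<lambda>(m, n, k). (rot m, n, k))"

text \<open>The weight comes from b a^m = q^m a^m b. The guard \<open>0 < n\<close> excludes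
  truncated subtraction, and \<open>n < 3\<close> encodes the vanishing cube of
  \<open>b\<close>.\<close>

definition opB :: "complex \<Rightarrow> mono linop" where
  "opB q = wshift (\<lambda>(m, n, k). if m < 3 \<and> 0 < n \<and> n < 3 then q ^ m else 0) (\<lambda>(m, n, k). (m, n - 1, k))"

definition opC :: "complex \<Rightarrow> mono linop" where
  "opC q = wshift (\<lambda>(m, n, k). if m < 3 \<and> 0 < k \<and> k < 3 then q ^ m else 0) (\<lambda>(m, n, k). (m, n, k - 1))"

text \<open>\<open>a\<^sup>3 = 1\<close> and \<open>a d = 1 + q\<^sup>-\<^sup>1 b c\<close> force \<open>d = a\<^sup>2 (1 + q\<^sup>-\<^sup>1 b c)\<close>, where \<open>q\<^sup>-\<^sup>1 = - 1 - q\<close>.\<close>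

definition opD :: "complex \<Rightarrow> mono linop" where
  "opD q = opA * opA * (1 - opB q * opC q - sc q * opB q * opC q)"

fun repA :: "complex \<Rightarrow> gen \<Rightarrow> mono linop" where
  "repA q Gen_a = opA" | "repA q Gen_b = opB q" | "repA q Gen_c = opC q" | "repA q Gen_d = opD q"
| "repA q _ = 0"

text \<open>\<open>opEa\<close>, ..., \<open>opEd\<close> are left multiplication by the generators of \<open>\<Lambda>\<close> in normal form;
  \<open>act_a\<close>, ..., \<open>act_d\<close> are the module action of \<open>A\<close> on \<open>\<Lambda>\<close> read off from the cross relations.
  All coefficients lie in \<open>\<int>[q]\<close> since \<open>\<mu> = 1 - q\<close>.\<close>

definition opEa :: "complex \<Rightarrow> (nat \<times> 'j) linop" where
  "opEa q = tab
    [(1, 0, 1), (5, 2, 1), (6, 3, 1), (7, 4, 1), (8, 1, 1 - q), (11, 8, 1), (12, 9, 1),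
     (13, 10, 1), (14, 7, 1 - q), (15, 14, 1)]"

definition opEb :: "complex \<Rightarrow> (nat \<times> 'j) linop" where
  "opEb q = tab
    [(2, 0, 1), (5, 1, - q), (8, 3, 1), (9, 1, 1 + 2 * q), (9, 4, 1), (11, 6, - q),
     (12, 7, - q), (14, 6, -1 + -2 * q), (14, 10, 1), (15, 13, - q)]"

definition opEc :: "complex \<Rightarrow> (nat \<times> 'j) linop" where
  "opEc q = tab
    [(3, 0, 1), (6, 1, 1 + q), (8, 2, -1), (10, 1, -1 + q), (10, 4, 1), (11, 5, -1 - q),
     (13, 7, 1 + q), (14, 5, -1 + q), (14, 9, -1), (15, 12, -1 - q)]"

definition opEd :: "complex \<Rightarrow> (nat \<times> 'j) linop" where
  "opEd q = tab
    [(4, 0, 1), (7, 1, -1), (8, 1, -1 + q), (9, 2, -1), (10, 3, -1), (12, 5, 1), (13, 6, 1),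
     (14, 7, -1 + q), (14, 8, 1), (15, 11, -1)]"

definition act_a :: "complex \<Rightarrow> (nat \<times> 'j) linop" where
  "act_a q = 1 + tab
    [(1, 1, -1 + q), (4, 1, 3 + 3 * q), (4, 4, -2 - q), (5, 5, -1 + q), (6, 6, -1 + q),
     (9, 5, -3 + -3 * q), (9, 9, -2 - q), (10, 10, -2 - q), (11, 11, -1 + q),
     (14, 14, -2 - q)]"

definition act_b :: "complex \<Rightarrow> (nat \<times> 'j) linop" where
  "act_b q = tab
    [(3, 1, 1 - q), (4, 2, 1 + 2 * q), (7, 5, -2 - q), (8, 5, -1 + q), (10, 7, 1 + 2 * q),
     (10, 8, -1 + -2 * q), (13, 11, 2 + q), (14, 12, -1 + -2 * q)]"

definition act_c :: "complex \<Rightarrow> (nat \<times> 'j) linop" where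
  "act_c q = tab
    [(2, 1, 1 - q), (4, 3, 1 + 2 * q), (7, 6, 1 - q), (8, 6, 1 - q), (9, 7, -2 - q),
     (9, 8, 1 + 2 * q), (12, 11, 1 - q), (14, 13, -2 - q)]"

definition act_d :: "complex \<Rightarrow> (nat \<times> 'j) linop" where
  "act_d q = 1 + tab
    [(1, 1, -2 - q), (4, 4, -1 + q), (5, 5, -2 - q), (6, 6, -2 - q), (9, 5, 3 + 3 * q),
     (9, 9, -1 + q), (10, 10, -1 + q), (11, 11, -2 - q), (14, 11, -3 + -3 * q),
     (14, 14, -1 + q)]"

lemmas op_defs = opEa_def opEb_def opEc_def opEd_def act_a_def act_b_def act_c_def act_d_def

fun rep :: "complex \<Rightarrow> gen \<Rightarrow> (nat \<times> mono) linop" where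
  "rep q Gen_a = act_a q * rgt opA + act_b q * rgt (opC q)"
| "rep q Gen_b = act_a q * rgt (opB q) + act_b q * rgt (opD q)"
| "rep q Gen_c = act_c q * rgt opA + act_d q * rgt (opC q)"
| "rep q Gen_d = act_c q * rgt (opB q) + act_d q * rgt (opD q)"
| "rep q Gen_ea = opEa q" | "rep q Gen_eb = opEb q" | "rep q Gen_ec = opEc q" | "rep q Gen_ed = opEd q"

lemma nat16_cases:
  fixes i :: nat
  obtains "i = 0" | "i = 1" | "i = 2" | "i = 3" | "i = 4" | "i = 5" | "i = 6" | "i = 7" | "i = 8"
    | "i = 9" | "i = 10" | "i = 11" | "i = 12" | "i = 13" | "i = 14" | "i = 15" | "i \<ge> 16"
proof -
  have "i < 16 \<Longrightarrow> i \<in> {0, 1, 2, 3, 4, 5, 6, 7, 8, 9, 10, 11, 12, 13, 14, 15}"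
    by simp presburger
  then show thesis using that by (cases "i < 16") auto
qed

text \<open>Equality is checked row by row; the rows from 16 on are given by inequations, the form
  in which the simplifier discards entries of a \<open>tab\<close>.\<close>

lemma linop_eqI16:
  assumes "\<And>f j i. i \<noteq> 0 \<Longrightarrow> i \<noteq> 1 \<Longrightarrow> i \<noteq> 2 \<Longrightarrow> i \<noteq> 3 \<Longrightarrow>
      i \<noteq> 4 \<Longrightarrow> i \<noteq> 5 \<Longrightarrow> i \<noteq> 6 \<Longrightarrow> i \<noteq> 7 \<Longrightarrow>
      i \<noteq> 8 \<Longrightarrow> i \<noteq> 9 \<Longrightarrow> i \<noteq> 10 \<Longrightarrow> i \<noteq> 11 \<Longrightarrow>
      i \<noteq> 12 \<Longrightarrow> i \<noteq> 13 \<Longrightarrow> i \<noteq> 14 \<Longrightarrow> i \<noteq> 15 \<Longrightarrow>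
      app X f (i, j) = app Y f (i, j)"
  "\<And>f j. app X f (0, j) = app Y f (0, j)" "\<And>f j. app X f (1, j) = app Y f (1, j)"
  "\<And>f j. app X f (2, j) = app Y f (2, j)" "\<And>f j. app X f (3, j) = app Y f (3, j)"
  "\<And>f j. app X f (4, j) = app Y f (4, j)" "\<And>f j. app X f (5, j) = app Y f (5, j)"
  "\<And>f j. app X f (6, j) = app Y f (6, j)" "\<And>f j. app X f (7, j) = app Y f (7, j)"
  "\<And>f j. app X f (8, j) = app Y f (8, j)" "\<And>f j. app X f (9, j) = app Y f (9, j)"
  "\<And>f j. app X f (10, j) = app Y f (10, j)" "\<And>f j. app X f (11, j) = app Y f (11, j)"
  "\<And>f j. app X f (12, j) = app Y f (12, j)" "\<And>f j. app X f (13, j) = app Y f (13, j)"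
  "\<And>f j. app X f (14, j) = app Y f (14, j)" "\<And>f j. app X f (15, j) = app Y f (15, j)"
  shows "X = (Y :: (nat \<times> 'j) linop)"
proof (rule linop_eqI)
  fix f :: "nat \<times> 'j \<Rightarrow> complex" and p :: "nat \<times> 'j"
  obtain i j where p: "p = (i, j)" by fastforce
  show "app X f p = app Y f p"
    unfolding p by (cases i rule: nat16_cases) (use assms in auto)
qed

section \<open>Arithmetic with the cube root of unity, and the relations of the operators\<close>

locale cuberoot =
  fixes q :: complex
  assumes q3: "q ^ 3 = 1" and q1: "q \<noteq> 1"
begin

text \<open>Together with \<open>qqx\<close>, which covers right-nested products, this reduces every
  polynomial in \<open>q\<close> to the form x + q y.\<close>

lemma qq: "q * q = - 1 - q"
proof -
  have "(q - 1) * (q * q + q + 1) = q ^ 3 - 1"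
    by (simp add: algebra_simps power3_eq_cube)
  then have "q * q + q + 1 = 0" using q3 q1 by simp
  then show ?thesis by (simp add: eq_neg_iff_add_eq_0 algebra_simps)
qed

lemma qqx: "q * (q * x) = - x - q * x"
  using qq by (metis (no_types, opaque_lifting) left_diff_distrib minus_mult_minus mult.assoc mult_1 mult_minus_left)

lemma q2: "q\<^sup>2 = - 1 - q"
  by (simp add: power2_eq_square qq)

lemma q0: "q \<noteq> 0"
  using q3 by auto

lemma qinv: "1 / q = - 1 - q"
  using q0 by (simp add: field_simps qq)

lemma q2inv: "1 / q\<^sup>2 = q"
proof -
  have "q * q\<^sup>2 = 1" using q3 by (simp add: power2_eq_square power3_eq_cube mult.assoc)
  then show ?thesis using q0 by (simp add: field_simps)
qed

lemma mu: "mu q = 1 - q"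
  by (simp add: mu_def q2inv)

lemmas q_simps = mu qinv q2inv q2

lemma op_relations:
  "opB q * opA = sc q * opA * opB q"
  "opC q * opA = sc q * opA * opC q"
  "opC q * opB q = opB q * opC q"
  "opA * opA * opA = 1"
  "opB q * opB q * opB q = 0"
  "opC q * opC q * opC q = 0"
proof -
  have case3: "m < 3 \<Longrightarrow> m = 0 \<or> m = 1 \<or> m = 2" for m :: nat by auto
  have rot: "rot m < 3 \<longleftrightarrow> m < 3" for m by (auto simp: rot_def)
  have rot3: "rot (rot (rot m)) = m" for m by (cases "m < 3") (auto simp: rot_def dest: case3)
  \<comment> \<open>At \<open>m = 0\<close> the exponent wraps around to 2, which is where
    \<open>q ^ 3 = 1\<close> enters.\<close>
  have qrot: "m < 3 \<Longrightarrow> q * q ^ rot m = q ^ m" for m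
    using case3[of m] q3 by (auto simp: rot_def power2_eq_square power3_eq_cube mult.assoc)
  show "opB q * opA = sc q * opA * opB q" "opC q * opA = sc q * opA * opC q"
    by (rule linop_eqI; auto simp: opA_def opB_def opC_def rot qrot simp flip: mult.assoc)+
  show "opC q * opB q = opB q * opC q"
    by (rule linop_eqI; auto simp: opB_def opC_def)
  show "opA * opA * opA = 1"
    by (rule linop_eqI; auto simp: opA_def rot3)
  show "opB q * opB q * opB q = 0" "opC q * opC q * opC q = 0"
    by (rule linop_eqI; auto simp: opB_def opC_def)+
qed

lemma Lambda_relations:
  "opEb q * opEb q = 0" "opEc q * opEc q = 0" "opEd q * opEd q = 0"
  "opEb q * opEc q + opEc q * opEb q = 0" "opEb q * opEd q + opEd q * opEb q = 0"
  "opEc q * opEd q + opEd q * opEc q = 0"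
  "opEa q * opEa q - sc (mu q) * opEb q * opEc q = 0"
  "opEa q * opEd q + opEd q * opEa q + sc (mu q) * opEb q * opEc q = 0"
  "opEa q * opEb q + sc (q\<^sup>2) * opEb q * opEa q - sc (mu q) * opEb q * opEd q = 0"
  "opEc q * opEa q + sc (q\<^sup>2) * opEa q * opEc q + sc (mu q) * opEc q * opEd q = 0"
  unfolding q_simps
  by (rule linop_eqI16; simp add: op_defs algebra_simps qq qqx)+

lemma act_relations:
  "act_b q * act_a q = sc q * act_a q * act_b q"
  "act_c q * act_a q = sc q * act_a q * act_c q"
  "act_d q * act_b q = sc q * act_b q * act_d q"
  "act_d q * act_c q = sc q * act_c q * act_d q"
  "act_c q * act_b q = act_b q * act_c q"
  "act_d q * act_a q = 1 + sc q * act_b q * act_c q"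
  "act_a q * act_d q = 1 - act_b q * act_c q - sc q * act_b q * act_c q"
  "act_a q * act_a q * act_a q = 1"
  "act_d q * act_d q * act_d q = 1"
  "act_b q * act_b q * act_b q = 0"
  "act_c q * act_c q * act_c q = 0"
  by (rule linop_eqI16; simp add: op_defs algebra_simps qq qqx)+

end

text \<open>Products are nested to the right during simplification, so a rule for
  \<open>x * y\<close> must also fire when a tail follows.\<close>

lemma mult_eq_left: "x * y = z \<Longrightarrow> x * (y * t) = z * t" for x y z t :: "'r::ring_1"
  by (metis mult.assoc)

text \<open>With \<open>a d = 1 + q\<^sup>-\<^sup>1 b c\<close>, the relation for \<open>d a - a d\<close> becomes \<open>d a = 1 + q b c\<close>.\<close>

definition sl2_rels :: "'r::ring_1 \<Rightarrow> 'r \<Rightarrow> 'r \<Rightarrow> 'r \<Rightarrow> 'r \<Rightarrow> bool" where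
  "sl2_rels Q a b c d \<longleftrightarrow>
     b * a = Q * a * b \<and> c * a = Q * a * c \<and> d * b = Q * b * d \<and> d * c = Q * c * d \<and> c * b = b * c \<and>
     d * a = 1 + Q * b * c \<and> a * d = 1 - b * c - Q * b * c \<and>
     a * a * a = 1 \<and> d * d * d = 1 \<and> b * b * b = 0 \<and> c * c * c = 0"

lemma sl2_rels_hom:
  assumes "sl2_rels Q a b c d"
    and h: "\<And>x y. h (x * y) = h x * h y" "\<And>x y. h (x + y) = h x + h y"
      "\<And>x y. h (x - y) = h x - h y" "h 1 = 1" "h 0 = 0"
  shows "sl2_rels (h Q) (h a) (h b) (h c) (h d)"
  using assms(1) unfolding sl2_rels_def by (intro conjI; metis h)

text \<open>Since -1 - Q is the inverse of Q, the last argument is the forced value of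
  \<open>d\<close>. Its cube is 1 because moving the powers of \<open>a\<close> to the left
  multiplies b c by successive powers of Q, leaving the product of 1 + Q^i b c over i = 0, 1, 2,
  which is 1 + (b c)^3.\<close>

lemma sl2_rels_reduced:
  fixes Q a b c :: "'r::ring_1"
  assumes Q: "Q * Q = - 1 - Q" "a * Q = Q * a" "b * Q = Q * b" "c * Q = Q * c"
    and r: "b * a = Q * a * b" "c * a = Q * a * c" "c * b = b * c"
    "a * a * a = 1" "b * b * b = 0" "c * c * c = 0"
  shows "sl2_rels Q a b c (a * a * (1 - b * c - Q * b * c))"
proof -
  have aaa: "a * (a * a) = 1" "a * (a * (a * t)) = t" for t
    using r(4) by (simp_all add: mult.assoc) (metis mult.assoc mult_1)
  have bbb: "b * (b * b) = 0" "b * (b * (b * t)) = 0" for t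
    using r(5) by (simp_all add: mult.assoc) (metis mult.assoc mult_zero_left)
  have ccc: "c * (c * c) = 0" "c * (c * (c * t)) = 0" for t
    using r(6) by (simp_all add: mult.assoc) (metis mult.assoc mult_zero_left)
  note rules = Q Q[THEN mult_eq_left] r(1-3) r(1-3)[THEN mult_eq_left] aaa bbb ccc
  show ?thesis
    unfolding sl2_rels_def by (intro conjI; simp add: algebra_simps rules)
qed

text \<open>The first hypothesis says y x = Q^2 x y, so this is the q-binomial theorem: the mixed
  terms carry the factor 1 + Q + Q^2 = 0.\<close>

lemma cube_add:
  fixes x y Q :: "'r::ring_1"
  assumes "y * x = - x * y - Q * x * y" "x * Q = Q * x" "y * Q = Q * y" "Q * Q = - 1 - Q"
  shows "(x + y) * (x + y) * (x + y) = x * x * x + y * y * y"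
  by (simp add: algebra_simps assms assms[THEN mult_eq_left])

text \<open>Compatibility of the matrix coproduct with the relations, for two commuting copies. In
  each entry the two summands commute up to Q^2, one Q from each copy, so \<open>cube_add\<close>
  reduces the cubes to those of the summands.\<close>

lemma sl2_rels_coproduct:
  fixes Q a b c d a' b' c' d' :: "'r::ring_1"
  assumes Q: "Q * Q = - 1 - Q" "a * Q = Q * a" "b * Q = Q * b" "c * Q = Q * c" "d * Q = Q * d"
     "a' * Q = Q * a'" "b' * Q = Q * b'" "c' * Q = Q * c'" "d' * Q = Q * d'"
    and r: "sl2_rels Q a b c d" "sl2_rels Q a' b' c' d'"
    and comm: "\<And>x y. x \<in> {a, b, c, d} \<Longrightarrow> y \<in> {a', b', c', d'} \<Longrightarrow> y * x = x * y"
  shows "sl2_rels Q (a * a' + b * c') (a * b' + b * d') (c * a' + d * c') (c * b' + d * d')"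
proof -
  have com: "a' * a = a * a'" "a' * b = b * a'" "a' * c = c * a'" "a' * d = d * a'"
    "b' * a = a * b'" "b' * b = b * b'" "b' * c = c * b'" "b' * d = d * b'"
    "c' * a = a * c'" "c' * b = b * c'" "c' * c = c * c'" "c' * d = d * c'"
    "d' * a = a * d'" "d' * b = b * d'" "d' * c = c * d'" "d' * d = d * d'"
    by (rule comm; simp)+
  have q: "b * a = Q * a * b" "c * a = Q * a * c" "d * b = Q * b * d" "d * c = Q * c * d" "c * b = b * c"
     "d * a = 1 + Q * b * c" "a * d = 1 - b * c - Q * b * c"
     "b' * a' = Q * a' * b'" "c' * a' = Q * a' * c'" "d' * b' = Q * b' * d'" "d' * c' = Q * c' * d'"
     "c' * b' = b' * c'" "d' * a' = 1 + Q * b' * c'" "a' * d' = 1 - b' * c' - Q * b' * c'"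
    using r unfolding sl2_rels_def by blast+
  have cubes: "a * a * a = 1" "d * d * d = 1" "b * b * b = 0" "c * c * c = 0"
    "a' * a' * a' = 1" "d' * d' * d' = 1" "b' * b' * b' = 0" "c' * c' * c' = 0"
    using r unfolding sl2_rels_def by blast+
  note rules = Q Q[THEN mult_eq_left] com com[THEN mult_eq_left] q q[THEN mult_eq_left]
  have cube_comm: "(x * y) * (x * y) * (x * y) = (x * x * x) * (y * y * y)" if "y * x = x * y" for x y :: 'r
    using that by (metis mult.assoc)
  have cube: "(x + y) * (x + y) * (x + y) = x * x * x + y * y * y"
    if "y * x = - x * y - Q * x * y" "x * Q = Q * x" "y * Q = Q * y" for x y
    using cube_add that Q(1) by blast
  show ?thesis
    unfolding sl2_rels_def
  proof (intro conjI)
    show "(a * a' + b * c') * (a * a' + b * c') * (a * a' + b * c') = 1"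
      by (subst cube) (simp_all add: cube_comm com cubes, simp_all add: algebra_simps rules)
    show "(c * b' + d * d') * (c * b' + d * d') * (c * b' + d * d') = 1"
      by (subst cube) (simp_all add: cube_comm com cubes, simp_all add: algebra_simps rules)
    show "(a * b' + b * d') * (a * b' + b * d') * (a * b' + b * d') = 0"
      by (subst cube) (simp_all add: cube_comm com cubes, simp_all add: algebra_simps rules)
    show "(c * a' + d * c') * (c * a' + d * c') * (c * a' + d * c') = 0"
      by (subst cube) (simp_all add: cube_comm com cubes, simp_all add: algebra_simps rules)
  qed (simp_all add: algebra_simps rules)
qed


lemma rgt_commute:
  "rgt X * opEa q = opEa q * rgt X" "rgt X * opEb q = opEb q * rgt X"
  "rgt X * opEc q = opEc q * rgt X" "rgt X * opEd q = opEd q * rgt X"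
  "rgt X * act_a q = act_a q * rgt X" "rgt X * act_b q = act_b q * rgt X"
  "rgt X * act_c q = act_c q * rgt X" "rgt X * act_d q = act_d q * rgt X"
  by (simp_all add: op_defs rgt_tab distrib_left distrib_right)

context cuberoot
begin

lemma sc_qq: "sc q * sc q = - 1 - sc q"
  by (rule linop_eqI) (simp add: qq qqx algebra_simps)

lemma sc_2: "sc 2 * X = X + X"
  by (rule linop_eqI) simp

lemma sl2_opA: "sl2_rels (sc q) opA (opB q) (opC q) (opD q)"
  unfolding opD_def
  by (rule sl2_rels_reduced) (rule sc_qq sc_commute op_relations)+

lemma sl2_act: "sl2_rels (sc q) (act_a q) (act_b q) (act_c q) (act_d q)"
  unfolding sl2_rels_def by (intro conjI) (rule act_relations)+

lemma sl2_rgt: "sl2_rels (sc q) (rgt opA) (rgt (opB q)) (rgt (opC q)) (rgt (opD q))"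
  using sl2_rels_hom[OF sl2_opA, of rgt] by (simp add: rgt_simps)

lemma sl2_rep: "sl2_rels (sc q) (rep q Gen_a) (rep q Gen_b) (rep q Gen_c) (rep q Gen_d)"
  unfolding rep.simps
  by (rule sl2_rels_coproduct[OF sc_qq _ _ _ _ _ _ _ _ sl2_act sl2_rgt])
    (auto simp: sc_commute rgt_commute)

text \<open>Multiples are spelled as repeated sums so that \<open>sc_simps\<close> can push
  \<open>sc\<close> inside without meeting numerals.\<close>

lemma q_mu: "q * mu q = 1 + q + q" "q * (mu q)\<^sup>2 = 1 + 1 + 1 + q + q + q"
  by (simp_all add: mu power2_eq_square algebra_simps qq qqx)

lemma ev_A_rels:
  assumes "sl2_rels (sc q) (\<phi> Gen_a) (\<phi> Gen_b) (\<phi> Gen_c) (\<phi> Gen_d)" "r \<in> A_rels q"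
  shows "ev \<phi> r = 0"
proof -
  have "\<forall>r\<in>A_rels q. ev \<phi> r = 0"
    using assms(1) unfolding sl2_rels_def A_rels_def q_mu ball_simps
    by (auto simp: ev_simps q_simps sc_simps sc_2 power3_eq_cube distrib_right left_diff_distrib)
  then show ?thesis using assms(2) by blast
qed

text \<open>Expanding a cross relation along the coproduct and comparing the operators on the second
  factor gives two identities between operators on the forms. They are the same for
  \<open>(a, c)\<close> and \<open>(b, d)\<close>, so one list serves both pairs.\<close>

lemma cross_relations:
  "act_a q * opEa q = sc q * opEa q * act_a q + sc (mu q) * opEc q * act_c q + sc (q * (mu q)\<^sup>2) * opEd q * act_a q"
  "act_b q * opEa q = sc q * opEa q * act_b q + sc (mu q) * opEc q * act_d q + sc (q * (mu q)\<^sup>2) * opEd q * act_b q"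
  "act_c q * opEa q = sc (1 / q) * opEa q * act_c q + sc (mu q) * opEb q * act_a q"
  "act_d q * opEa q = sc (1 / q) * opEa q * act_d q + sc (mu q) * opEb q * act_b q"
  "act_a q * opEb q = opEb q * act_a q + sc (q * mu q) * opEd q * act_c q"
  "act_b q * opEb q = opEb q * act_b q + sc (q * mu q) * opEd q * act_d q"
  "act_c q * opEb q = opEb q * act_c q"
  "act_d q * opEb q = opEb q * act_d q"
  "act_a q * opEc q = opEc q * act_a q"
  "act_b q * opEc q = opEc q * act_b q"
  "act_c q * opEc q = opEc q * act_c q + sc (q * mu q) * opEd q * act_a q"
  "act_d q * opEc q = opEc q * act_d q + sc (q * mu q) * opEd q * act_b q"
  "act_a q * opEd q = sc (1 / q) * opEd q * act_a q"
  "act_b q * opEd q = sc (1 / q) * opEd q * act_b q"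
  "act_c q * opEd q = sc q * opEd q * act_c q"
  "act_d q * opEd q = sc q * opEd q * act_d q"
  unfolding q_mu unfolding q_simps
  by (rule linop_eqI16; simp add: op_defs algebra_simps qq qqx)+

lemma ev_cross_rels:
  assumes "r \<in> cross_rels q"
  shows "ev (rep q) r = 0"
proof -
  have E_sc: "X * sc z = sc z * X" "X * (sc z * Y) = sc z * (X * Y)" if "X \<in> {opEa q, opEb q, opEc q, opEd q}"
    for X z and Y :: "(nat \<times> mono) linop"
    by (rule sc_commute, metis sc_commute mult.assoc)
  have "\<forall>r\<in>cross_rels q. ev (rep q) r = 0"
    unfolding cross_rels_def
    by (simp add: ev_simps distrib_left distrib_right mult.assoc rgt_commute cross_relations E_sc
      rgt_commute[THEN mult_eq_left] cross_relations[THEN mult_eq_left])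
  then show ?thesis using assms by blast
qed

lemma ev_Lambda_rels:
  assumes "r \<in> Lambda_rels q"
  shows "ev (rep q) r = 0"
proof -
  have "\<forall>r\<in>Lambda_rels q. ev (rep q) r = 0"
    unfolding Lambda_rels_def ball_simps
    by (simp add: ev_simps Lambda_relations)
  then show ?thesis using assms by blast
qed

lemma ev_Omega_rels: "r \<in> Omega_rels q \<Longrightarrow> ev (rep q) r = 0"
  unfolding Omega_rels_def using ev_cross_rels ev_Lambda_rels ev_A_rels[OF sl2_rep] by blast

lemma ev_rep_J: "x \<in> O.J q \<Longrightarrow> ev (rep q) x = 0"
  using O.ev_J ev_Omega_rels by blast

lemma ev_repA_J: "x \<in> A.J q \<Longrightarrow> ev (repA q) x = 0"
  using A.ev_J[of q "repA q"] ev_A_rels[of "repA q"] sl2_opA by simp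

end

section \<open>Normal forms\<close>

context presentation
begin

text \<open>These are the preimages of the linear subspaces of the quotient: containing
  \<open>J\<close> makes membership insensitive to the relations.\<close>

definition submod :: "falg set \<Rightarrow> bool" where
  "submod U \<longleftrightarrow> J \<subseteq> U \<and> U \<subseteq> carrier F \<and> (\<forall>x\<in>U. \<forall>y\<in>U. x + y \<in> U) \<and> (\<forall>x\<in>U. \<forall>z. scal z * x \<in> U)"

lemma submodI:
  assumes "J \<subseteq> U" "U \<subseteq> carrier F" "\<And>x y. x \<in> U \<Longrightarrow> y \<in> U \<Longrightarrow> x + y \<in> U"
    "\<And>x z. x \<in> U \<Longrightarrow> scal z * x \<in> U"
  shows "submod U"
  using assms unfolding submod_def by blast

lemma submodD:
  assumes "submod U"
  shows submod_J: "x \<in> J \<Longrightarrow> x \<in> U"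
    and submod_carrier: "x \<in> U \<Longrightarrow> x \<in> carrier F"
    and submod_add: "x \<in> U \<Longrightarrow> y \<in> U \<Longrightarrow> x + y \<in> U"
    and submod_scal: "x \<in> U \<Longrightarrow> scal z * x \<in> U"
  using assms unfolding submod_def by blast+

lemma submod_uminus: "submod U \<Longrightarrow> x \<in> U \<Longrightarrow> - x \<in> U"
  using submod_scal[of U x "- 1"] by (simp add: scal_simps)

lemma submod_diff: "submod U \<Longrightarrow> x \<in> U \<Longrightarrow> y \<in> U \<Longrightarrow> x - y \<in> U"
  using submod_add[of U x "- y"] submod_uminus[of U y] by simp

lemma submod_zero: "submod U \<Longrightarrow> 0 \<in> U"
  using submod_J[OF _ J_zero] .

text \<open>A single rewriting step: the relation \<open>r\<close> is applied at the front of
  \<open>x\<close>, with \<open>v\<close> as the untouched tail.\<close>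

lemma submod_rel:
  assumes "submod U" "p \<in> U" "r \<in> J" "v \<in> carrier F" "x = p + r * v"
  shows "x \<in> U"
  using assms by (simp add: submod_add submod_J J_mult_right)

text \<open>The normal forms are built up one generator at a time: \<open>lvl g U V = U + g V\<close>.\<close>

definition lvl :: "falg \<Rightarrow> falg set \<Rightarrow> falg set \<Rightarrow> falg set" where
  "lvl g U V = {u + g * v | u v. u \<in> U \<and> v \<in> V}"

lemma lvlI: "u \<in> U \<Longrightarrow> v \<in> V \<Longrightarrow> u + g * v \<in> lvl g U V"
  unfolding lvl_def by blast

lemma lvl_left: "submod V \<Longrightarrow> u \<in> U \<Longrightarrow> u \<in> lvl g U V"
  using lvlI[of u U 0 V g] by (simp add: submod_zero)

lemma lvl_right: "submod U \<Longrightarrow> v \<in> V \<Longrightarrow> g * v \<in> lvl g U V"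
  using lvlI[of 0 U v V g] by (simp add: submod_zero)

lemma submod_lvl:
  assumes U: "submod U" and V: "submod V" and g: "g \<in> carrier F"
  shows "submod (lvl g U V)"
proof (rule submodI)
  show "J \<subseteq> lvl g U V"
    using lvl_left[OF V] submod_J[OF U] by blast
  show "lvl g U V \<subseteq> carrier F"
    unfolding lvl_def using submod_carrier[OF U] submod_carrier[OF V] g
    by (auto intro!: add_in_free_ring mult_in_free_ring)
next
  fix x y assume "x \<in> lvl g U V" "y \<in> lvl g U V"
  then obtain u v u' v' where "u \<in> U" "v \<in> V" "x = u + g * v" "u' \<in> U" "v' \<in> V" "y = u' + g * v'"
    unfolding lvl_def by blast
  then have "x + y = (u + u') + g * (v + v')" "u + u' \<in> U" "v + v' \<in> V"
    using U V by (simp_all add: algebra_simps submod_add)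
  then show "x + y \<in> lvl g U V" by (metis lvlI)
next
  fix x z assume "x \<in> lvl g U V"
  then obtain u v where uv: "u \<in> U" "v \<in> V" "x = u + g * v"
    unfolding lvl_def by blast
  have "scal z * x = scal z * u + g * (scal z * v)"
    unfolding uv(3) by (simp add: distrib_left) (metis mult.assoc scal_commute)
  then show "scal z * x \<in> lvl g U V"
    using submod_scal[OF U uv(1)] submod_scal[OF V uv(2)] by (metis lvlI)
qed

lemma lvl_closed:
  assumes "submod W" "\<And>u. u \<in> U \<Longrightarrow> h * u \<in> W" "\<And>v. v \<in> V \<Longrightarrow> h * (g * v) \<in> W" "p \<in> lvl g U V"
  shows "h * p \<in> W"
  using assms unfolding lvl_def by (auto simp: distrib_left submod_add)

lemma lvl_commute:
  assumes U: "submod U" and V: "submod V" and g: "g \<in> carrier F"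
    and h: "h * g - scal z * g * h \<in> J"
    and "\<And>u. u \<in> U \<Longrightarrow> h * u \<in> U" and hV: "\<And>v. v \<in> V \<Longrightarrow> h * v \<in> V"
    and "p \<in> lvl g U V"
  shows "h * p \<in> lvl g U V"
proof (rule lvl_closed[OF submod_lvl[OF U V g] _ _ assms(7)])
  fix v assume v: "v \<in> V"
  show "h * (g * v) \<in> lvl g U V"
    by (rule submod_rel[OF submod_lvl[OF U V g] submod_scal[OF submod_lvl[OF U V g] lvl_right[OF U hV[OF v]]]
          h submod_carrier[OF V v]]) (simp add: algebra_simps)
qed (use assms lvl_left in blast)

end

text \<open>The scalars sit innermost because the spanning argument builds normal forms from the
  right, starting with scalars.\<close>

definition comb :: "(nat \<Rightarrow> nat \<Rightarrow> nat \<Rightarrow> complex) \<Rightarrow> falg" where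
  "comb f = (\<Sum>m<3. ga ^ m * (\<Sum>n<3. gb ^ n * (\<Sum>k<3. gc ^ k * scal (f m n k))))"

lemma gen_A: "ga \<in> carrier (free_ring A_gens)" "gb \<in> carrier (free_ring A_gens)"
  "gc \<in> carrier (free_ring A_gens)" "gd \<in> carrier (free_ring A_gens)"
  by (simp_all add: gen_in_free_ring A_gens_def)

lemma zero_in_free_ring: "0 \<in> carrier (free_ring S)"
  by (simp add: free_ring_def)

lemma sum_in_free_ring: "(\<And>i. i \<in> K \<Longrightarrow> f i \<in> carrier (free_ring S)) \<Longrightarrow> sum f K \<in> carrier (free_ring S)"
  by (induction K rule: infinite_finite_induct) (auto simp: zero_in_free_ring add_in_free_ring)

lemma comb_in_free_ring: "comb f \<in> carrier (free_ring A_gens)"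
  unfolding comb_def
  by (intro sum_in_free_ring mult_in_free_ring power_in_free_ring scal_in_free_ring gen_A)

context cuberoot
begin

subsection \<open>The coordinate algebra\<close>

text \<open>\<open>?lvl3 g U\<close> is U + g U + g^2 U, and \<open>Qa\<close> is the tower of these
  for \<open>gc\<close>, \<open>gb\<close>, \<open>ga\<close> over the scalars. It contains the
  scalars and is stable under left multiplication by all four generators, so it is the whole free
  algebra.\<close>

lemma A_span:
  assumes "x \<in> carrier (free_ring A_gens)"
  obtains f where "x - comb f \<in> A.J q"
proof -
  let ?J = "A.J q" and ?F = "free_ring A_gens"
  note sma = A.submod_add[where q = q] and smc = A.submod_carrier[where q = q]
    and sms = A.submod_scal[where q = q]
  let ?lvl3 = "\<lambda>g U. A.lvl g U (A.lvl g U U)"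
  have sub3: "A.submod q (?lvl3 g U)" if "A.submod q U" "g \<in> carrier ?F" for g U
    using that by (intro A.submod_lvl)
  have left3: "u \<in> ?lvl3 g U" if "A.submod q U" "g \<in> carrier ?F" "u \<in> U" for g U u
    using that by (intro A.lvl_left A.submod_lvl)
  have gen3: "g * p \<in> ?lvl3 g U"
    if U: "A.submod q U" and g: "g \<in> carrier ?F" and c: "g ^ 3 - scal z \<in> ?J" and p: "p \<in> ?lvl3 g U" for g z U p
  proof (rule A.lvl_closed[OF sub3[OF U g] _ _ p])
    fix u assume "u \<in> U"
    then show "g * u \<in> ?lvl3 g U"
      using U g by (intro A.lvl_right A.lvl_left)
  next
    fix v assume v: "v \<in> A.lvl g U U"
    show "g * (g * v) \<in> ?lvl3 g U"
    proof -
      have "g * v' \<in> A.lvl g U U" if "v' \<in> U" for v'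
        using U that by (rule A.lvl_right)
      moreover have "g * (g * (g * w)) \<in> ?lvl3 g U" if w: "w \<in> U" for w
        by (rule left3[OF U g], rule A.submod_rel[OF U sms[OF U w] c smc[OF U w]])
          (simp add: power3_eq_cube algebra_simps)
      moreover obtain v' w where "v = v' + g * w" "v' \<in> U" "w \<in> U"
        using v unfolding A.lvl_def by blast
      moreover have "g * (g * v') \<in> ?lvl3 g U" if "g * v' \<in> A.lvl g U U" for v'
        using U that by (rule A.lvl_right)
      ultimately show ?thesis
        using sma[OF sub3[OF U g]] by (simp add: distrib_left)
    qed
  qed
  have com3: "h * p \<in> ?lvl3 g U"
    if U: "A.submod q U" and g: "g \<in> carrier ?F" and c: "h * g - scal z * g * h \<in> ?J"
      and p: "p \<in> ?lvl3 g U" and h: "\<And>u. u \<in> U \<Longrightarrow> h * u \<in> U" for g h z U p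
  proof (rule A.lvl_commute[OF U A.submod_lvl[OF U U g] g c h _ p])
    fix v assume v: "v \<in> A.lvl g U U"
    show "h * v \<in> A.lvl g U U" by (rule A.lvl_commute[OF U U g c h h v])
  qed
  have rep3: "\<exists>f. p - (\<Sum>n<3. g ^ n * r (f n)) \<in> ?J"
    if U: "\<And>u. u \<in> U \<Longrightarrow> \<exists>f. u - r f \<in> ?J" and g: "g \<in> carrier ?F" and p: "p \<in> ?lvl3 g U" for g U r p
  proof -
    obtain u v w where p: "p = u + g * (v + g * w)" "u \<in> U" "v \<in> U" "w \<in> U"
      using p unfolding A.lvl_def by blast
    obtain fu fv fw where f: "u - r fu \<in> ?J" "v - r fv \<in> ?J" "w - r fw \<in> ?J"
      using U p by meson
    let ?f = "\<lambda>n. if n = 0 then fu else if n = 1 then fv else fw"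
    have "p - (\<Sum>n<3. g ^ n * r (?f n)) = (u - r fu) + g * (v - r fv) + g * (g * (w - r fw))"
      by (simp add: p(1) algebra_simps numeral_3_eq_3)
    also have "\<dots> \<in> ?J"
      using f g by (intro A.J_add A.J_mult_left)
    finally show ?thesis by (rule exI[of _ ?f])
  qed

  define Q0 where "Q0 = {scal z + j | z j. j \<in> ?J}"
  define Qc where "Qc = ?lvl3 gc Q0"
  define Qb where "Qb = ?lvl3 gb Qc"
  define Qa where "Qa = ?lvl3 ga Qb"
  have Q0: "A.submod q Q0"
  proof (rule A.submodI)
    show "?J \<subseteq> Q0" unfolding Q0_def by (force intro: exI[of _ 0] simp: scal_simps)
    show "Q0 \<subseteq> carrier ?F"
      unfolding Q0_def using A.J_carrier by (auto intro!: add_in_free_ring scal_in_free_ring)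
  next
    fix x y assume "x \<in> Q0" "y \<in> Q0"
    then obtain z j z' j' where "x = scal z + j" "y = scal z' + j'" "j \<in> ?J" "j' \<in> ?J"
      unfolding Q0_def by blast
    then have "x + y = scal (z + z') + (j + j')" "j + j' \<in> ?J"
      by (simp_all add: scal_simps A.J_add)
    then show "x + y \<in> Q0" unfolding Q0_def by blast
  next
    fix x z assume "x \<in> Q0"
    then obtain z' j where "x = scal z' + j" "j \<in> ?J"
      unfolding Q0_def by blast
    then have "scal z * x = scal (z * z') + scal z * j" "scal z * j \<in> ?J"
      by (simp_all add: scal_simps distrib_left A.J_scal)
    then show "scal z * x \<in> Q0" unfolding Q0_def by blast
  qed
  have Qc: "A.submod q Qc" unfolding Qc_def by (intro sub3 Q0 gen_A)
  have Qb: "A.submod q Qb" unfolding Qb_def by (intro sub3 Qc gen_A)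
  have Qa: "A.submod q Qa" unfolding Qa_def by (intro sub3 Qb gen_A)
  have rels: "gb * ga - scal q * ga * gb \<in> ?J" "gc * ga - scal q * ga * gc \<in> ?J"
     "gc * gb - scal 1 * gb * gc \<in> ?J" "ga^3 - scal 1 \<in> ?J" "gb^3 - scal 0 \<in> ?J" "gc^3 - scal 0 \<in> ?J"
     "ga * gd - scal (1 / q) * gb * gc - 1 \<in> ?J"
    by (rule A.J_rel; simp add: A_rels_def scal_simps)+
  have c_Qc: "gc * p \<in> Qc" if "p \<in> Qc" for p
    using that unfolding Qc_def by (rule gen3[OF Q0 gen_A(3) rels(6)])
  have b_Qb: "gb * p \<in> Qb" if "p \<in> Qb" for p
    using that unfolding Qb_def by (rule gen3[OF Qc gen_A(2) rels(5)])
  have c_Qb: "gc * p \<in> Qb" if "p \<in> Qb" for p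
    using that unfolding Qb_def by (rule com3[OF Qc gen_A(2) rels(3)]) (rule c_Qc)
  have a_Qa: "ga * p \<in> Qa" if "p \<in> Qa" for p
    using that unfolding Qa_def by (rule gen3[OF Qb gen_A(1) rels(4)])
  have b_Qa: "gb * p \<in> Qa" if "p \<in> Qa" for p
    using that unfolding Qa_def by (rule com3[OF Qb gen_A(1) rels(1)]) (rule b_Qb)
  have c_Qa: "gc * p \<in> Qa" if "p \<in> Qa" for p
    using that unfolding Qa_def by (rule com3[OF Qb gen_A(1) rels(2)]) (rule c_Qb)
  have d_Qa: "gd * p \<in> Qa" if p: "p \<in> Qa" for p
  proof -
    \<comment> \<open>\<open>d = a\<^sup>3 d = a\<^sup>2 (1 + q\<^sup>-\<^sup>1 b c)\<close>\<close>
    have r: "ga * ga * (ga * gd - scal (1 / q) * gb * gc - 1) - (ga^3 - scal 1) * gd \<in> ?J"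
      by (rule A.J_diff, rule A.J_mult_left[OF rels(7) mult_in_free_ring[OF gen_A(1) gen_A(1)]],
          rule A.J_mult_right[OF rels(4) gen_A(4)])
    have m: "scal (1 / q) * (ga * (ga * (gb * (gc * p)))) + ga * (ga * p) \<in> Qa"
      using p by (intro sma[OF Qa] sms[OF Qa] a_Qa b_Qa c_Qa)
    have com: "ga * (scal (1 / q) * t) = scal (1 / q) * (ga * t)" for t
      by (metis scal_commute mult.assoc)
    show ?thesis
      by (rule A.submod_rel[OF Qa m r smc[OF Qa p]])
        (simp add: algebra_simps power3_eq_cube scal_simps com)
  qed
  have scal_Qa: "scal z \<in> Qa" for z
  proof -
    have "scal z \<in> Q0" unfolding Q0_def using A.J_zero by force
    then have "scal z \<in> Qc" unfolding Qc_def by (rule left3[OF Q0 gen_A(3)])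
    then have "scal z \<in> Qb" unfolding Qb_def by (rule left3[OF Qc gen_A(2)])
    then show ?thesis unfolding Qa_def by (rule left3[OF Qb gen_A(1)])
  qed
  have "x \<in> Qa"
    using assms
  proof (induction x rule: free_ring_induct)
    case (gen g x)
    then show ?case using a_Qa b_Qa c_Qa d_Qa by (auto simp: A_gens_def)
  qed (simp_all add: scal_Qa sma[OF Qa])
  moreover have "\<exists>z. p - scal z \<in> ?J" if "p \<in> Q0" for p
    using that unfolding Q0_def by (clarify, rule_tac x = z in exI) simp
  then have "\<exists>f. p - (\<Sum>n<3. gc ^ n * scal (f n)) \<in> ?J" if "p \<in> Qc" for p
    using rep3[of Q0 scal gc p] that gen_A unfolding Qc_def by blast
  then have "\<exists>f. p - (\<Sum>n<3. gb ^ n * (\<Sum>k<3. gc ^ k * scal (f n k))) \<in> ?J" if "p \<in> Qb" for p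
    using rep3[of Qc "\<lambda>f. (\<Sum>n<3. gc ^ n * scal (f n))" gb p] that gen_A unfolding Qb_def by blast
  then have "\<exists>f. p - comb f \<in> ?J" if "p \<in> Qa" for p
    using rep3[of Qb "\<lambda>f. (\<Sum>n<3. gb ^ n * (\<Sum>k<3. gc ^ k * scal (f n k)))" ga p] that gen_A
    unfolding Qa_def comb_def by blast
  ultimately show thesis using that by blast
qed


section \<open>Coordinates of functions with respect to the 27 monomials\<close>

definition delta :: "'j \<Rightarrow> 'j \<Rightarrow> complex" where
  "delta p = (\<lambda>p'. if p' = p then 1 else 0)"

definition phi :: "falg \<Rightarrow> mono \<Rightarrow> complex" where
  "phi x = app (ev (repA q) x) (delta (0, 0, 0))"

lemma phi_simps:
  "phi (x + y) p = phi x p + phi y p" "phi (x - y) p = phi x p - phi y p" "phi (- x) p = - phi x p"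
  "phi (scal z * x) p = z * phi x p" "phi 0 p = 0"
  by (simp_all add: phi_def ev_simps)

lemma app_delta:
  "m < 3 \<Longrightarrow> app (opA ^ m) (delta (0, n, k)) = delta (m, n, k)"
  "n < 3 \<Longrightarrow> app (opB q ^ n) (delta (0, 0, k)) = delta (0, n, k)"
  "k < 3 \<Longrightarrow> app (opC q ^ k) (delta (0, 0, 0)) = delta (0, 0, k)"
proof -
  have case3: "m < 3 \<Longrightarrow> m = 0 \<or> m = 1 \<or> m = 2" for m :: nat by auto
  show "m < 3 \<Longrightarrow> app (opA ^ m) (delta (0, n, k)) = delta (m, n, k)"
    by (drule case3) (auto simp: fun_eq_iff opA_def delta_def rot_def power2_eq_square split: if_splits)
  show "n < 3 \<Longrightarrow> app (opB q ^ n) (delta (0, 0, k)) = delta (0, n, k)"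
    by (drule case3) (auto simp: fun_eq_iff opB_def delta_def power2_eq_square)
  show "k < 3 \<Longrightarrow> app (opC q ^ k) (delta (0, 0, 0)) = delta (0, 0, k)"
    by (drule case3) (auto simp: fun_eq_iff opC_def delta_def power2_eq_square)
qed

lemma phi_comb: "phi (comb f) (m, n, k) = (if m < 3 \<and> n < 3 \<and> k < 3 then f m n k else 0)"
proof -
  have app_sum_left: "app (\<Sum>i\<in>K. X i) f = (\<lambda>j. \<Sum>i\<in>K. app (X i) f j)" for K :: "nat set" and X :: "nat \<Rightarrow> mono linop" and f
    by (induction K rule: infinite_finite_induct) (auto simp: fun_eq_iff)
  have sc: "app (sc z) (delta (0, 0, 0)) = (\<lambda>i. z * delta (0, 0, 0) i)" for z :: complex
    by (rule ext) simp
  have "phi (comb f) = (\<lambda>j. \<Sum>m<3. \<Sum>n<3. \<Sum>k<3. f m n k * delta (m, n, k) j)"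
    unfolding phi_def comb_def
    by (simp add: ev_sum ev_simps app_sum_left app_sum sc app_mult)
      (intro ext sum.cong refl, simp add: app_delta)
  moreover have "(\<Sum>k'<3. f m' n' k' * delta (m', n', k') (m, n, k)) =
      (if m' = m \<and> n' = n \<and> k < 3 then f m n k else 0)" for m' n'
    by (cases "m' = m \<and> n' = n") (auto simp: delta_def if_distrib[of "\<lambda>x. _ * x"] sum.delta cong: if_cong)
  moreover have "(\<Sum>n'<3. if m' = m \<and> n' = n \<and> k < 3 then f m n k else 0) =
      (if m' = m \<and> n < 3 \<and> k < 3 then f m n k else 0)" for m'
    by (cases "m' = m \<and> k < 3") (auto simp: sum.delta)
  moreover have "(\<Sum>m'<3. if m' = m \<and> n < 3 \<and> k < 3 then f m n k else 0) =
      (if m < 3 \<and> n < 3 \<and> k < 3 then f m n k else 0)"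
    by (cases "n < 3 \<and> k < 3") (auto simp: sum.delta)
  ultimately show ?thesis by simp
qed

definition supp3 :: "(mono \<Rightarrow> complex) \<Rightarrow> bool" where
  "supp3 X \<longleftrightarrow> (\<forall>m n k. \<not> (m < 3 \<and> n < 3 \<and> k < 3) \<longrightarrow> X (m, n, k) = 0)"

lemma phi_surj:
  assumes "supp3 X"
  obtains x where "x \<in> carrier (free_ring A_gens)" "phi x = X"
proof
  show "comb (\<lambda>m n k. X (m, n, k)) \<in> carrier (free_ring A_gens)" by (rule comb_in_free_ring)
  show "phi (comb (\<lambda>m n k. X (m, n, k))) = X"
    using assms unfolding supp3_def by (auto simp: phi_comb)
qed

lemma phi_J: "x \<in> A.J q \<Longrightarrow> phi x = (\<lambda>p. 0)"
  by (simp add: phi_def ev_repA_J fun_eq_iff)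

lemma phi_supp3:
  assumes "x \<in> carrier (free_ring A_gens)"
  shows "supp3 (phi x)"
proof -
  obtain f where "x - comb f \<in> A.J q" using A_span[OF assms] .
  then have "phi x p = phi (comb f) p" for p
    using phi_J[of "x - comb f"] by (metis phi_simps(2) right_minus_eq)
  then show ?thesis by (simp add: supp3_def phi_comb)
qed

text \<open>The coordinates of a normal form are its coefficients, so vanishing coordinates leave
  only the error term of \<open>A_span\<close>. This is the independence of the 27
  monomials.\<close>

lemma phi_eq_0_iff:
  assumes "x \<in> carrier (free_ring A_gens)"
  shows "phi x = (\<lambda>p. 0) \<longleftrightarrow> x \<in> A.J q"
proof
  assume 0: "phi x = (\<lambda>p. 0)"
  obtain f where f: "x - comb f \<in> A.J q" using A_span[OF assms] .
  then have "phi (comb f) p = 0" for p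
    using phi_J[of "x - comb f"] 0 by (metis phi_simps(2) right_minus_eq)
  then have "f m n k = 0" if "m < 3" "n < 3" "k < 3" for m n k
    using phi_comb[of f m n k] that by simp
  then have "comb f = 0" unfolding comb_def by (simp add: scal_simps)
  then show "x \<in> A.J q" using f by simp
qed (rule phi_J)

subsection \<open>The algebra of forms\<close>

definition emb :: "nat \<Rightarrow> (mono \<Rightarrow> complex) \<Rightarrow> nat \<times> mono \<Rightarrow> complex" where
  "emb s X = (\<lambda>(i, j). if i = s then X j else 0)"

definition Phi :: "falg \<Rightarrow> nat \<times> mono \<Rightarrow> complex" where
  "Phi p = app (ev (rep q) p) (emb 0 (delta (0, 0, 0)))"

definition ebas :: "falg list" where
  "ebas = [1, ea, eb, ec, ed, ea * eb, ea * ec, ea * ed, eb * ec, eb * ed, ec * ed,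
     ea * eb * ec, ea * eb * ed, ea * ec * ed, eb * ec * ed, ea * eb * ec * ed]"

lemma emb_app [simp]: "emb s X (i, j) = (if i = s then X j else 0)"
  by (simp add: emb_def)

text \<open>On the unit form \<open>A\<close> acts by the counit: \<open>act_a\<close> and
  \<open>act_d\<close> fix it, \<open>act_b\<close> and \<open>act_c\<close> kill it. Hence only the
  action on the second factor survives.\<close>

lemma rep_emb:
  assumes "x \<in> carrier (free_ring A_gens)"
  shows "app (ev (rep q) x) (emb 0 X) = emb 0 (app (ev (repA q) x) X)"
  using assms
proof (induction x rule: free_ring_induct)
  case (scal z)
  show ?case by (auto simp: ev_simps emb_def)
next
  case (gen g x)
  have "app (rep q g) (emb 0 Y) = emb 0 (app (repA q g) Y)" for Y
    using gen.hyps by (auto simp: A_gens_def fun_eq_iff op_defs app_zero)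
  then show ?case by (simp add: ev_simps gen.IH)
qed (auto simp: ev_simps fun_eq_iff)

lemma ebas_emb: "i < 16 \<Longrightarrow> app (ev (rep q) (ebas ! i)) (emb 0 X) = emb i X"
  by (cases i rule: nat16_cases) (auto simp: ebas_def ev_simps fun_eq_iff op_defs)

lemma Phi_simps:
  "Phi (x + y) p = Phi x p + Phi y p" "Phi (x - y) p = Phi x p - Phi y p" "Phi (- x) p = - Phi x p"
  "Phi 0 p = 0"
  by (simp_all add: Phi_def ev_simps)

lemma Phi_A: "x \<in> carrier (free_ring A_gens) \<Longrightarrow> Phi (p * x) = app (ev (rep q) p) (emb 0 (phi x))"
  by (simp add: Phi_def phi_def ev_mult rep_emb)

lemma Phi_comb:
  assumes "\<And>i. i < 16 \<Longrightarrow> x i \<in> carrier (free_ring A_gens)"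
  shows "Phi (\<Sum>i<16. ebas ! i * x i) (s, j) = (if s < 16 then phi (x s) j else 0)"
proof -
  have "Phi (\<Sum>i\<in>K. ebas ! i * x i) (s, j) = (\<Sum>i\<in>K. if i = s then phi (x i) j else 0)" if "K \<subseteq> {..<16}" for K
  proof -
    have "finite K" using that by (rule finite_subset) simp
    then show ?thesis using that
      by induction (auto simp: Phi_simps Phi_A assms ebas_emb)
  qed
  from this[of "{..<16}"] show ?thesis by simp
qed

lemma sum_16:
  fixes f :: "nat \<Rightarrow> 'b::comm_monoid_add"
  shows "(\<Sum>i<16. f i) = f 0 + f 1 + f 2 + f 3 + f 4 + f 5 + f 6 + f 7 + f 8 + f 9 + f 10 + f 11 + f 12
    + f 13 + f 14 + f 15"
  by (simp add: eval_nat_numeral)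

text \<open>The order \<open>ea\<close>, \<open>eb\<close>, \<open>ec\<close>, \<open>ed\<close>,
  then functions is chosen so that moving a function past a form generator produces only this
  generator and later ones. Each stage is therefore stable under the functions as soon as the stages
  inside it are.\<close>

lemma Omega_span:
  "\<exists>x. (\<forall>i<16. x i \<in> carrier (free_ring A_gens)) \<and> p - (\<Sum>i<16. ebas ! i * x i) \<in> O.J q"
proof -
  let ?J = "O.J q" and ?F = "free_ring A_gens"
  note sma = O.submod_add[where q = q] and sms = O.submod_scal[where q = q]
  define P0 where "P0 = {x + j | x j. x \<in> carrier ?F \<and> j \<in> ?J}"
  define Ud where "Ud = O.lvl ed P0 P0"
  define Uc where "Uc = O.lvl ec Ud Ud"
  define Ub where "Ub = O.lvl eb Uc Uc"
  define Ua where "Ua = O.lvl ea Ub Ub"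
  have P0: "O.submod q P0"
  proof (rule O.submodI)
    show "?J \<subseteq> P0" unfolding P0_def using zero_in_free_ring[of A_gens] by force
  next
    fix x y assume "x \<in> P0" "y \<in> P0"
    then obtain u j u' j' where "x = u + j" "y = u' + j'" "u \<in> carrier ?F" "u' \<in> carrier ?F" "j \<in> ?J" "j' \<in> ?J"
      unfolding P0_def by blast
    then have "x + y = (u + u') + (j + j')" "u + u' \<in> carrier ?F" "j + j' \<in> ?J"
      by (simp_all add: add_in_free_ring O.J_add)
    then show "x + y \<in> P0" unfolding P0_def by blast
  next
    fix x z assume "x \<in> P0"
    then obtain u j where "x = u + j" "u \<in> carrier ?F" "j \<in> ?J"
      unfolding P0_def by blast
    then have "scal z * x = scal z * u + scal z * j" "scal z * u \<in> carrier ?F" "scal z * j \<in> ?J"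
      by (simp_all add: distrib_left mult_in_free_ring scal_in_free_ring O.J_scal)
    then show "scal z * x \<in> P0" unfolding P0_def by blast
  qed auto
  have Ud: "O.submod q Ud" unfolding Ud_def by (intro O.submod_lvl P0 UNIV_free_ring)
  have Uc: "O.submod q Uc" unfolding Uc_def by (intro O.submod_lvl Ud UNIV_free_ring)
  have Ub: "O.submod q Ub" unfolding Ub_def by (intro O.submod_lvl Uc UNIV_free_ring)
  have Ua: "O.submod q Ua" unfolding Ua_def by (intro O.submod_lvl Ub UNIV_free_ring)
  have left_Ud: "P0 \<subseteq> Ud" unfolding Ud_def by (rule subsetI) (rule O.lvl_left[OF P0])
  have right_Ud: "p \<in> P0 \<Longrightarrow> ed * p \<in> Ud" for p
    unfolding Ud_def by (rule O.lvl_right[OF P0])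
  have left_Uc: "Ud \<subseteq> Uc" unfolding Uc_def by (rule subsetI) (rule O.lvl_left[OF Ud])
  have right_Uc: "p \<in> Ud \<Longrightarrow> ec * p \<in> Uc" for p
    unfolding Uc_def by (rule O.lvl_right[OF Ud])
  have left_Ub: "Uc \<subseteq> Ub" unfolding Ub_def by (rule subsetI) (rule O.lvl_left[OF Uc])
  have right_Ub: "p \<in> Uc \<Longrightarrow> eb * p \<in> Ub" for p
    unfolding Ub_def by (rule O.lvl_right[OF Uc])
  have left_Ua: "Ub \<subseteq> Ua" unfolding Ua_def by (rule subsetI) (rule O.lvl_left[OF Ub])
  have right_Ua: "p \<in> Ub \<Longrightarrow> ea * p \<in> Ua" for p
    unfolding Ua_def by (rule O.lvl_right[OF Ub])
  note left = left_Ud left_Uc left_Ub left_Ua and right = right_Ud right_Uc right_Ub right_Ua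
  have reduce: "x \<in> W" if "O.submod q W" "p \<in> W" "r \<in> Omega_rels q" "x = p + r * v" for W p r v x
    by (rule O.submod_rel[OF that(1,2) O.J_rel[OF that(3)] UNIV_free_ring that(4)])
  have rL: "r \<in> Lambda_rels q \<Longrightarrow> r \<in> Omega_rels q" and rC: "r \<in> cross_rels q \<Longrightarrow> r \<in> Omega_rels q" for r
    by (auto simp: Omega_rels_def)
  have sq: "g * (g * v) \<in> W" if "O.submod q W" "g \<in> {eb, ec, ed}" for g v W
    by (rule reduce[OF that(1) O.submod_zero[OF that(1)] rL, of "g * g" _ v])
      (use that(2) in \<open>auto simp: Lambda_rels_def mult.assoc\<close>)
  have anti: "h * (g * v) \<in> W" if W: "O.submod q W" "g * (h * v) \<in> W" and gh: "(g, h) \<in> {(eb, ec), (eb, ed), (ec, ed)}"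
    for g h v W
    by (rule reduce[OF W(1) O.submod_uminus[OF W] rL, of "g * h + h * g" _ v])
      (use gh in \<open>auto simp: Lambda_rels_def algebra_simps\<close>)
  have d_Ud: "ed * p \<in> Ud" if "p \<in> Ud" for p
    by (rule O.lvl_closed[OF Ud _ _ that[unfolded Ud_def]]) (rule right_Ud, assumption, rule sq[OF Ud], simp)
  have c_Uc: "ec * p \<in> Uc" if "p \<in> Uc" for p
    by (rule O.lvl_closed[OF Uc _ _ that[unfolded Uc_def]]) (rule right_Uc, assumption, rule sq[OF Uc], simp)
  have d_Uc: "ed * p \<in> Uc" if "p \<in> Uc" for p
    by (rule O.lvl_closed[OF Uc _ _ that[unfolded Uc_def]])
      (rule subsetD[OF left_Uc], rule d_Ud, assumption,
       rule anti[OF Uc], rule right_Uc, rule d_Ud, assumption, simp)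
  have b_Ub: "eb * p \<in> Ub" if "p \<in> Ub" for p
    by (rule O.lvl_closed[OF Ub _ _ that[unfolded Ub_def]]) (rule right_Ub, assumption, rule sq[OF Ub], simp)
  have c_Ub: "ec * p \<in> Ub" if "p \<in> Ub" for p
    by (rule O.lvl_closed[OF Ub _ _ that[unfolded Ub_def]])
      (rule subsetD[OF left_Ub], rule c_Uc, assumption,
       rule anti[OF Ub], rule right_Ub, rule c_Uc, assumption, simp)
  have d_Ub: "ed * p \<in> Ub" if "p \<in> Ub" for p
    by (rule O.lvl_closed[OF Ub _ _ that[unfolded Ub_def]])
      (rule subsetD[OF left_Ub], rule d_Uc, assumption,
       rule anti[OF Ub], rule right_Ub, rule d_Uc, assumption, simp)
  have a_Ua: "ea * p \<in> Ua" if "p \<in> Ua" for p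
  proof (rule O.lvl_closed[OF Ua _ _ that[unfolded Ua_def]])
    fix v assume "v \<in> Ub"
    then have "scal (mu q) * (eb * (ec * v)) \<in> Ua" by (intro sms[OF Ua] subsetD[OF left_Ua] b_Ub c_Ub)
    then show "ea * (ea * v) \<in> Ua"
      by (rule reduce[OF Ua _ rL, of _ "ea * ea - scal (mu q) * eb * ec" _ v])
        (auto simp: Lambda_rels_def algebra_simps)
  qed (rule right_Ua)
  have b_Ua: "eb * p \<in> Ua" if "p \<in> Ua" for p
  proof (rule O.lvl_closed[OF Ua _ _ that[unfolded Ua_def]])
    fix v assume "v \<in> Ub"
    \<comment> \<open>Solving the relation for \<open>eb * ea\<close> means dividing by
      \<open>q\<^sup>2\<close>, that is, multiplying by \<open>q\<close>.\<close>
    then have 1: "scal q * (scal (mu q) * (eb * (ed * v)) - ea * (eb * v)) \<in> Ua"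
      by (intro sms[OF Ua] O.submod_diff[OF Ua] right_Ua subsetD[OF left_Ua] b_Ub d_Ub)
    have q3': "q * q\<^sup>2 = 1" using q3 by (simp add: power2_eq_square power3_eq_cube mult.assoc)
    have q: "scal q * (scal (q\<^sup>2) * t) = t" for t
      by (simp add: q3' flip: mult.assoc scal_simps(6)) (simp add: scal_simps)
    have "scal q * (ea * eb + scal (q\<^sup>2) * eb * ea - scal (mu q) * eb * ed) \<in> ?J"
      by (intro O.J_scal O.J_rel rL) (simp add: Lambda_rels_def)
    then show "eb * (ea * v) \<in> Ua"
      by (rule O.submod_rel[OF Ua 1 _ UNIV_free_ring]) (simp add: algebra_simps q)
  qed (rule subsetD[OF left_Ua], rule b_Ub)
  have c_Ua: "ec * p \<in> Ua" if "p \<in> Ua" for p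
  proof (rule O.lvl_closed[OF Ua _ _ that[unfolded Ua_def]])
    fix v assume "v \<in> Ub"
    then have "- (scal (q\<^sup>2) * (ea * (ec * v))) - scal (mu q) * (ec * (ed * v)) \<in> Ua"
      by (intro O.submod_diff[OF Ua] O.submod_uminus[OF Ua] sms[OF Ua] right_Ua subsetD[OF left_Ua] c_Ub d_Ub)
    then show "ec * (ea * v) \<in> Ua"
      by (rule reduce[OF Ua _ rL, of _ "ec * ea + scal (q\<^sup>2) * ea * ec + scal (mu q) * ec * ed" _ v])
        (auto simp: Lambda_rels_def algebra_simps)
  qed (rule subsetD[OF left_Ua], rule c_Ub)
  have d_Ua: "ed * p \<in> Ua" if "p \<in> Ua" for p
  proof (rule O.lvl_closed[OF Ua _ _ that[unfolded Ua_def]])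
    fix v assume "v \<in> Ub"
    then have "- (ea * (ed * v)) - scal (mu q) * (eb * (ec * v)) \<in> Ua"
      by (intro O.submod_diff[OF Ua] O.submod_uminus[OF Ua] sms[OF Ua] right_Ua subsetD[OF left_Ua] b_Ub c_Ub d_Ub)
    then show "ed * (ea * v) \<in> Ua"
      by (rule reduce[OF Ua _ rL, of _ "ea * ed + ed * ea + scal (mu q) * eb * ec" _ v])
        (auto simp: Lambda_rels_def algebra_simps)
  qed (rule subsetD[OF left_Ua], rule d_Ub)

  have A_P0: "gen g * p \<in> P0" if "p \<in> P0" "g \<in> A_gens" for g p
    using that unfolding P0_def
    by (clarsimp simp: distrib_left) (blast intro: mult_in_free_ring gen_in_free_ring O.J_mult_left UNIV_free_ring)
  \<comment> \<open>Stability under \<open>u\<close> and \<open>v\<close> has to climb the tower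
    jointly, since the cross relations turn one into the other.\<close>
  have pair: "(\<forall>p\<in>Ua. u * p \<in> Ua) \<and> (\<forall>p\<in>Ua. v * p \<in> Ua)" if uv: "(u, v) \<in> {(ga, gc), (gb, gd)}" for u v
  proof -
    have u_P0: "u * p \<in> P0" "v * p \<in> P0" if "p \<in> P0" for p
      using A_P0[OF that] uv by (auto simp: A_gens_def)
    have rels: "v * eb - eb * v \<in> Omega_rels q" "u * ec - ec * u \<in> Omega_rels q"
       "u * ed - scal (1 / q) * ed * u \<in> Omega_rels q" "v * ed - scal q * ed * v \<in> Omega_rels q"
       "u * eb - (eb * u + scal (q * mu q) * ed * v) \<in> Omega_rels q"
       "v * ec - (ec * v + scal (q * mu q) * ed * u) \<in> Omega_rels q"
       "v * ea - (scal (1 / q) * ea * v + scal (mu q) * eb * u) \<in> Omega_rels q"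
       "u * ea - (scal q * ea * u + scal (mu q) * ec * v + scal (q * (mu q)^2) * ed * u) \<in> Omega_rels q"
      using uv by (auto simp: Omega_rels_def cross_rels_def)
    have u_Ud: "u * p \<in> Ud" if "p \<in> Ud" for p
    proof (rule O.lvl_closed[OF Ud _ _ that[unfolded Ud_def]])
      fix w assume "w \<in> P0"
      then have "scal (1 / q) * (ed * (u * w)) \<in> Ud" by (intro sms[OF Ud] right_Ud u_P0)
      then show "u * (ed * w) \<in> Ud"
        by (rule reduce[OF Ud _ rels(3), of _ _ w]) (simp add: algebra_simps)
    qed (rule subsetD[OF left_Ud], rule u_P0)
    have v_Ud: "v * p \<in> Ud" if "p \<in> Ud" for p
    proof (rule O.lvl_closed[OF Ud _ _ that[unfolded Ud_def]])
      fix w assume "w \<in> P0"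
      then have "scal q * (ed * (v * w)) \<in> Ud" by (intro sms[OF Ud] right_Ud u_P0)
      then show "v * (ed * w) \<in> Ud"
        by (rule reduce[OF Ud _ rels(4), of _ _ w]) (simp add: algebra_simps)
    qed (rule subsetD[OF left_Ud], rule u_P0)
    have u_Uc: "u * p \<in> Uc" if "p \<in> Uc" for p
    proof (rule O.lvl_closed[OF Uc _ _ that[unfolded Uc_def]])
      fix w assume "w \<in> Ud"
      then have "ec * (u * w) \<in> Uc" by (intro right_Uc u_Ud)
      then show "u * (ec * w) \<in> Uc"
        by (rule reduce[OF Uc _ rels(2), of _ _ w]) (simp add: algebra_simps)
    qed (rule subsetD[OF left_Uc], rule u_Ud)
    have v_Uc: "v * p \<in> Uc" if "p \<in> Uc" for p
    proof (rule O.lvl_closed[OF Uc _ _ that[unfolded Uc_def]])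
      fix w assume "w \<in> Ud"
      then have "ec * (v * w) + scal (q * mu q) * (ed * (u * w)) \<in> Uc"
        by (intro sma[OF Uc] sms[OF Uc] right_Uc subsetD[OF left_Uc] d_Ud u_Ud v_Ud)
      then show "v * (ec * w) \<in> Uc"
        by (rule reduce[OF Uc _ rels(6), of _ _ w]) (simp add: algebra_simps)
    qed (rule subsetD[OF left_Uc], rule v_Ud)
    have u_Ub: "u * p \<in> Ub" if "p \<in> Ub" for p
    proof (rule O.lvl_closed[OF Ub _ _ that[unfolded Ub_def]])
      fix w assume "w \<in> Uc"
      then have "eb * (u * w) + scal (q * mu q) * (ed * (v * w)) \<in> Ub"
        by (intro sma[OF Ub] sms[OF Ub] right_Ub subsetD[OF left_Ub] d_Uc u_Uc v_Uc)
      then show "u * (eb * w) \<in> Ub"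
        by (rule reduce[OF Ub _ rels(5), of _ _ w]) (simp add: algebra_simps)
    qed (rule subsetD[OF left_Ub], rule u_Uc)
    have v_Ub: "v * p \<in> Ub" if "p \<in> Ub" for p
    proof (rule O.lvl_closed[OF Ub _ _ that[unfolded Ub_def]])
      fix w assume "w \<in> Uc"
      then have "eb * (v * w) \<in> Ub" by (intro right_Ub v_Uc)
      then show "v * (eb * w) \<in> Ub"
        by (rule reduce[OF Ub _ rels(1), of _ _ w]) (simp add: algebra_simps)
    qed (rule subsetD[OF left_Ub], rule v_Uc)
    have "u * p \<in> Ua" if "p \<in> Ua" for p
    proof (rule O.lvl_closed[OF Ua _ _ that[unfolded Ua_def]])
      fix w assume "w \<in> Ub"
      then have "scal q * (ea * (u * w)) + scal (mu q) * (ec * (v * w)) + scal (q * (mu q)^2) * (ed * (u * w)) \<in> Ua"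
        by (intro sma[OF Ua] sms[OF Ua] right_Ua subsetD[OF left_Ua] c_Ub d_Ub u_Ub v_Ub)
      then show "u * (ea * w) \<in> Ua"
        by (rule reduce[OF Ua _ rels(8), of _ _ w]) (simp add: algebra_simps)
    qed (rule subsetD[OF left_Ua], rule u_Ub)
    moreover have "v * p \<in> Ua" if "p \<in> Ua" for p
    proof (rule O.lvl_closed[OF Ua _ _ that[unfolded Ua_def]])
      fix w assume "w \<in> Ub"
      then have "scal (1 / q) * (ea * (v * w)) + scal (mu q) * (eb * (u * w)) \<in> Ua"
        by (intro sma[OF Ua] sms[OF Ua] right_Ua subsetD[OF left_Ua] b_Ub u_Ub v_Ub)
      then show "v * (ea * w) \<in> Ua"
        by (rule reduce[OF Ua _ rels(7), of _ _ w]) (simp add: algebra_simps)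
    qed (rule subsetD[OF left_Ua], rule v_Ub)
    ultimately show ?thesis by blast
  qed
  have "p \<in> carrier (free_ring UNIV)" by simp
  then have "p \<in> Ua"
  proof (induction p rule: free_ring_induct)
    case (scal z)
    have "scal z \<in> P0"
      unfolding P0_def using O.J_zero[of q] scal_in_free_ring[of z A_gens] by force
    then show ?case using left by blast
  next
    case (gen g x)
    then show ?case
      using a_Ua b_Ua c_Ua d_Ua pair[of ga gc] pair[of gb gd] by (cases g) auto
  qed (rule sma[OF Ua])
  then obtain p0 p1 p2 p3 where p: "p = p0 + eb * p1 + ea * (p2 + eb * p3)"
    and in_Uc: "p0 \<in> Uc" "p1 \<in> Uc" "p2 \<in> Uc" "p3 \<in> Uc"
    unfolding Ua_def Ub_def O.lvl_def by blast
  have Uc_rep: "\<exists>a b c d. s = a + ed * b + ec * (c + ed * d) \<and> a \<in> P0 \<and> b \<in> P0 \<and> c \<in> P0 \<and> d \<in> P0"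
    if "s \<in> Uc" for s
    using that unfolding Uc_def Ud_def O.lvl_def by blast
  obtain a0 b0 c0 d0 where p0: "p0 = a0 + ed * b0 + ec * (c0 + ed * d0)"
    and P0_0: "a0 \<in> P0" "b0 \<in> P0" "c0 \<in> P0" "d0 \<in> P0"
    using Uc_rep[OF in_Uc(1)] by blast
  obtain a1 b1 c1 d1 where p1: "p1 = a1 + ed * b1 + ec * (c1 + ed * d1)"
    and P0_1: "a1 \<in> P0" "b1 \<in> P0" "c1 \<in> P0" "d1 \<in> P0"
    using Uc_rep[OF in_Uc(2)] by blast
  obtain a2 b2 c2 d2 where p2: "p2 = a2 + ed * b2 + ec * (c2 + ed * d2)"
    and P0_2: "a2 \<in> P0" "b2 \<in> P0" "c2 \<in> P0" "d2 \<in> P0"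
    using Uc_rep[OF in_Uc(3)] by blast
  obtain a3 b3 c3 d3 where p3: "p3 = a3 + ed * b3 + ec * (c3 + ed * d3)"
    and P0_3: "a3 \<in> P0" "b3 \<in> P0" "c3 \<in> P0" "d3 \<in> P0"
    using Uc_rep[OF in_Uc(4)] by blast
  note p = p[unfolded p0 p1 p2 p3]
  \<comment> \<open>The digits 0, 1, 2, 3 stand for the left factors 1, \<open>eb\<close>,
    \<open>ea\<close>, \<open>ea * eb\<close>, the letters a, b, c, d for the right factors 1,
    \<open>ed\<close>, \<open>ec\<close>, \<open>ec * ed\<close>; the list follows the order of
    \<open>ebas\<close>.\<close>
  define u where "u i = [a0, a2, a1, c0, b0, a3, c2, b2, c1, b1, d0, c3, b3, d2, d1, d3] ! i" for i
  have u: "u i \<in> P0" if "i < 16" for i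
    using that by (cases i rule: nat16_cases) (simp_all add: u_def P0_0 P0_1 P0_2 P0_3)
  have p: "p = (\<Sum>i<16. ebas ! i * u i)"
    unfolding sum_16 by (simp add: p u_def ebas_def algebra_simps)
  have "\<exists>x\<in>carrier ?F. u i - x \<in> ?J" if "i < 16" for i
    using u[OF that] unfolding P0_def by force
  then obtain x where x: "\<And>i. i < 16 \<Longrightarrow> x i \<in> carrier ?F \<and> u i - x i \<in> ?J"
    by metis
  have "p - (\<Sum>i<16. ebas ! i * x i) = (\<Sum>i<16. ebas ! i * (u i - x i))"
    by (simp add: p right_diff_distrib sum_subtractf)
  also have "\<dots> \<in> ?J"
    using x by (intro O.J_sum O.J_mult_left UNIV_free_ring) auto
  finally show ?thesis using x by blast
qed

lemma Phi_eq_0_iff: "Phi p = (\<lambda>_. 0) \<longleftrightarrow> p \<in> O.J q"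
proof
  assume 0: "Phi p = (\<lambda>_. 0)"
  obtain x where x: "\<And>i. i < 16 \<Longrightarrow> x i \<in> carrier (free_ring A_gens)"
    "p - (\<Sum>i<16. ebas ! i * x i) \<in> O.J q" using Omega_span[of p] by blast
  then have "Phi (\<Sum>i<16. ebas ! i * x i) t = 0" for t
    using ev_rep_J[OF x(2)] 0 Phi_simps(2)[of p "\<Sum>i<16. ebas ! i * x i" t] by (simp add: Phi_def)
  then have "phi (x i) j = 0" if "i < 16" for i j
    using Phi_comb[of x i j] x(1) that by simp
  then have "x i \<in> A.J q" if "i < 16" for i
    using phi_eq_0_iff[OF x(1)[OF that]] that by auto
  then have "(\<Sum>i<16. ebas ! i * x i) \<in> O.J q"
    using A_ideal_subset[of q] by (intro O.J_sum O.J_mult_left UNIV_free_ring) auto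
  from O.J_add[OF x(2) this] show "p \<in> O.J q" by simp
qed (simp add: Phi_def ev_rep_J fun_eq_iff)

text \<open>Freeness over the functions, in the form that makes the Hodge operator well
  defined.\<close>

lemma comb_J:
  assumes "\<And>i. i < 16 \<Longrightarrow> x i \<in> carrier (free_ring A_gens)"
    and "(\<Sum>i<16. ebas ! i * x i) \<in> O.J q" and "i < 16"
  shows "x i \<in> O.J q"
proof -
  have "Phi (\<Sum>i<16. ebas ! i * x i) = (\<lambda>_. 0)"
    using Phi_eq_0_iff assms(2) by blast
  then have "phi (x i) j = 0" for j
    using Phi_comb[of x i j, OF assms(1)] assms(3) by simp
  then show ?thesis
    using phi_eq_0_iff[OF assms(1)[OF assms(3)]] A_ideal_subset[of q] by auto
qed

end

section \<open>Multiplication by \<open>\<theta>\<close> and the Laplacian in coordinates\<close>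

text \<open>\<open>sg n\<close> is the \<open>q\<close>-integer of \<open>n\<close> up to a power of \<open>q\<close>, and \<open>1 - q\<close> is \<open>\<mu>\<close>. The operators are
  written by target: the value at \<open>(m, n, k)\<close> is a weight times the value at the source monomial.\<close>

definition sg :: "nat \<Rightarrow> complex" where
  "sg n = (if n mod 3 = 0 then 0 else if n mod 3 = 1 then 1 else - 1)"

text \<open>Each \<open>a\<close> or \<open>b\<close> passes \<open>ea\<close> with factor q, each
  \<open>c\<close> with its inverse, which is q^2.\<close>

definition tauA :: "complex \<Rightarrow> mono linop" where
  "tauA q = wshift (\<lambda>(m, n, k). if m < 3 \<and> n < 3 \<and> k < 3 then q ^ (m + n + 2 * k) else 0) (\<lambda>p. p)"

text \<open>The source of this term is the relation for c e_a: one \<open>c\<close> is traded for an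
  \<open>a\<close>, and \<open>sg\<close> sums over the choices of that \<open>c\<close>.\<close>

definition tauB :: "complex \<Rightarrow> mono linop" where
  "tauB q = wshift (\<lambda>(m, n, k). if m < 3 \<and> n < 3 \<and> k < 2 then (1 - q) * q ^ n * sg (k + 1) else 0)
    (\<lambda>(m, n, k). (rot m, n, k + 1))"

text \<open>The first summand trades \<open>b\<close> for the leading part a^2 of \<open>d\<close>.
  The second trades \<open>a\<close> for \<open>c\<close> and absorbs the b c part of
  \<open>d\<close>.\<close>

definition tauC :: "complex \<Rightarrow> mono linop" where
  "tauC q =
    wshift (\<lambda>(m, n, k). if m < 3 \<and> n < 2 \<and> k < 3 then (1 - q) * sg (n + 1) * q ^ (2 * k) else 0)
      (\<lambda>(m, n, k). (rot (rot m), n + 1, k)) +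
    wshift (\<lambda>(m, n, k). if m < 3 \<and> n < 3 \<and> 0 < k \<and> k < 3
        then (1 - q) * sg (rot (rot m) + n) * q ^ (rot (rot m) + 2 * k) else 0)
      (\<lambda>(m, n, k). (rot (rot m), n, k - 1))"

text \<open>The constant - 3 q^2 is q mu^2, the coefficient of \<open>ed\<close> in the cross
  relation for u e_a.\<close>

definition tauD :: "complex \<Rightarrow> mono linop" where
  "tauD q =
    wshift (\<lambda>(m, n, k). if m < 3 \<and> n < 3 \<and> k < 3
        then q ^ (k + 2 * m + 2 * n) - 3 * q ^ 2 * sg (m + n) * sg (k + 1) else 0) (\<lambda>p. p) +
    wshift (\<lambda>(m, n, k). if m < 3 \<and> n < 2 \<and> k < 2
        then - 3 * q ^ (2 * m + 2) * sg (n + 1) * sg (k + 1) else 0)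
      (\<lambda>(m, n, k). (m, n + 1, k + 1))"

text \<open>The identity on genuine monomials. It replaces 1 in the partial derivatives for
  \<open>ea\<close> and \<open>ed\<close>, so that their values vanish on junk exponents.\<close>

definition trunc :: "mono linop" where
  "trunc = wshift (\<lambda>(m, n, k). if m < 3 \<and> n < 3 \<and> k < 3 then 1 else 0) (\<lambda>p. p)"

text \<open>The shift strictly lowers the exponents of \<open>b\<close> and \<open>c\<close>, so the
  operator is triangular: its kernel is found by back substitution.\<close>

definition box :: "complex \<Rightarrow> mono linop" where
  "box q =
    wshift (\<lambda>(m, n, k). if m < 3 \<and> n < 3 \<and> k < 3 \<and> (m + n + k) mod 3 = 2 then 6 * (q + 1) else 0) (\<lambda>p. p) +
    wshift (\<lambda>(m, n, k). if m < 3 \<and> n < 2 \<and> k < 2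
        then 6 * q ^ (2 * m + 2) * sg (n + 1) * sg (k + 1) else 0) (\<lambda>(m, n, k). (m, n + 1, k + 1))"

lemmas tau_defs = tauA_def tauB_def tauC_def tauD_def trunc_def box_def

lemma mono_linop_eqI:
  fixes X Y :: "mono linop"
  assumes "\<And>f m n k. \<not> m < 3 \<Longrightarrow> app X f (m, n, k) = app Y f (m, n, k)"
    and "\<And>f m n k. \<not> n < 3 \<Longrightarrow> app X f (m, n, k) = app Y f (m, n, k)"
    and "\<And>f m n k. \<not> k < 3 \<Longrightarrow> app X f (m, n, k) = app Y f (m, n, k)"
    and "\<And>f. \<forall>m\<in>{0, 1, 2}. \<forall>n\<in>{0, 1, 2}. \<forall>k\<in>{0, 1, 2}. app X f (m, n, k) = app Y f (m, n, k)"
  shows "X = Y"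
proof (rule linop_eqI)
  have case3: "m < 3 \<Longrightarrow> m \<in> {0, 1, 2}" for m :: nat by auto
  fix f :: "mono \<Rightarrow> complex" and p :: mono
  obtain m n k where p: "p = (m, n, k)" by (cases p)
  show "app X f p = app Y f p"
    unfolding p using assms(1-3)[of _ f] assms(4)[of f] case3 by blast
qed

lemma rot_less [simp]: "rot m < 3 \<longleftrightarrow> m < 3"
  by (auto simp: rot_def)

lemma rot_numeral: "rot 0 = 2" "rot 1 = 0" "rot (Suc 0) = 0" "rot 2 = 1"
  by (simp_all add: rot_def)

context cuberoot
begin

lemma qpow: "q ^ 4 = q" "q ^ 5 = - 1 - q" "q ^ 6 = 1" "q ^ 7 = q" "q ^ 8 = - 1 - q"
  "q ^ 9 = 1" "q ^ 10 = q"
  using q3 by (simp_all add: eval_nat_numeral qq qqx algebra_simps)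

lemmas tau_simps = tau_defs numeral_2_eq_2[symmetric] q0 opA_def opB_def opC_def opD_def rot_numeral sg_def qq qqx q2 q3 qpow algebra_simps

lemmas tau_junk = tau_defs opA_def opB_def opC_def opD_def

text \<open>Associativity in coordinates: in a (x theta) = (a x) theta, \<open>a\<close> is moved
  past the form generators and the coefficients of each are compared. \<open>tau_B\<close> and
  \<open>tau_C\<close> do the same for \<open>b\<close> and \<open>c\<close>.\<close>

lemma tau_A:
  "tauA q * opA = sc q * opA * tauA q"
  "tauB q * opA = opA * tauB q"
  "tauC q * opA = opA * tauC q + sc (mu q) * opC q * tauA q"
  "tauD q * opA = sc (1 / q) * opA * tauD q + sc (q * mu q) * opC q * tauB q + sc (q * (mu q)\<^sup>2) * opA * tauA q"
  unfolding q_mu unfolding q_simps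
  by (rule mono_linop_eqI; ((simp only: ball_simps; intro conjI TrueI; simp add: tau_simps) | simp add: tau_junk))+

lemma tau_B:
  "tauA q * opB q = sc q * opB q * tauA q"
  "tauB q * opB q = opB q * tauB q"
  "tauC q * opB q = opB q * tauC q + sc (mu q) * opD q * tauA q"
  "tauD q * opB q = sc (1 / q) * opB q * tauD q + sc (q * mu q) * opD q * tauB q + sc (q * (mu q)\<^sup>2) * opB q * tauA q"
  unfolding q_mu unfolding q_simps
  by (rule mono_linop_eqI; ((simp only: ball_simps; intro conjI TrueI; simp add: tau_simps) | simp add: tau_junk))+

lemma tau_C:
  "tauA q * opC q = sc (1 / q) * opC q * tauA q"
  "tauB q * opC q = opC q * tauB q + sc (mu q) * opA * tauA q"
  "tauC q * opC q = opC q * tauC q"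
  "tauD q * opC q = sc q * opC q * tauD q + sc (q * mu q) * opA * tauC q"
  unfolding q_mu unfolding q_simps
  by (rule mono_linop_eqI; ((simp only: ball_simps; intro conjI TrueI; simp add: tau_simps) | simp add: tau_junk))+

text \<open>The right-hand side is the volume coefficient of d star d x. Only the derivatives for
  \<open>ea\<close> and \<open>ed\<close> have a subtracted identity, because theta is
  \<open>ea + ed\<close>.\<close>

lemma box_eq:
  "box q = - (sc (mu q) * (tauA q - trunc) * (tauA q - trunc) - (tauD q - trunc) * (tauA q - trunc)
     + tauC q * tauB q + sc (q\<^sup>2) * tauB q * tauC q - (tauA q - trunc) * (tauD q - trunc))"
  unfolding q_simps
  by (rule mono_linop_eqI; ((simp only: ball_simps; intro conjI TrueI; simp add: tau_simps) | simp add: tau_junk))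


definition tauvec :: "(mono \<Rightarrow> complex) \<Rightarrow> nat \<times> mono \<Rightarrow> complex" where
  "tauvec X = (\<lambda>(i, j). if i = 1 then app (tauA q) X j else if i = 2 then app (tauB q) X j
     else if i = 3 then app (tauC q) X j else if i = 4 then app (tauD q) X j else 0)"

lemma tauvec_app:
  "tauvec X (0, j) = 0" "tauvec X (1, j) = app (tauA q) X j" "tauvec X (2, j) = app (tauB q) X j"
  "tauvec X (3, j) = app (tauC q) X j" "tauvec X (4, j) = app (tauD q) X j"
  "tauvec X (Suc 0, j) = app (tauA q) X j"
  "i > 4 \<Longrightarrow> tauvec X (i, j) = 0"
  by (simp_all add: tauvec_def)

lemma app_eqI:
  assumes "X = (Y :: 'i linop)"
  shows "app X f p = app Y f p"
  by (simp add: assms)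

lemma tau_app:
  "app (tauA q) (app opA X) j = q * app opA (app (tauA q) X) j"
  "app (tauB q) (app opA X) j = app opA (app (tauB q) X) j"
  "app (tauC q) (app opA X) j = app opA (app (tauC q) X) j + (1 - q) * app (opC q) (app (tauA q) X) j"
  "app (tauD q) (app opA X) j = (- 1 - q) * app opA (app (tauD q) X) j
     + (1 + q + q) * app (opC q) (app (tauB q) X) j + (1 + 1 + 1 + q + q + q) * app opA (app (tauA q) X) j"
  "app (tauA q) (app (opB q) X) j = q * app (opB q) (app (tauA q) X) j"
  "app (tauB q) (app (opB q) X) j = app (opB q) (app (tauB q) X) j"
  "app (tauC q) (app (opB q) X) j = app (opB q) (app (tauC q) X) j + (1 - q) * app (opD q) (app (tauA q) X) j"
  "app (tauD q) (app (opB q) X) j = (- 1 - q) * app (opB q) (app (tauD q) X) j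
     + (1 + q + q) * app (opD q) (app (tauB q) X) j + (1 + 1 + 1 + q + q + q) * app (opB q) (app (tauA q) X) j"
  "app (tauA q) (app (opC q) X) j = (- 1 - q) * app (opC q) (app (tauA q) X) j"
  "app (tauB q) (app (opC q) X) j = app (opC q) (app (tauB q) X) j + (1 - q) * app opA (app (tauA q) X) j"
  "app (tauC q) (app (opC q) X) j = app (opC q) (app (tauC q) X) j"
  "app (tauD q) (app (opC q) X) j = q * app (opC q) (app (tauD q) X) j + (1 + q + q) * app opA (app (tauC q) X) j"
  using tau_A[THEN app_eqI, of X j] tau_B[THEN app_eqI, of X j] tau_C[THEN app_eqI, of X j]
  unfolding q_mu unfolding q_simps by (simp_all add: mult.assoc)

lemma rep_tauvec:
  "app (rep q Gen_a) (tauvec X) = tauvec (app opA X)"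
  "app (rep q Gen_b) (tauvec X) = tauvec (app (opB q) X)"
  "app (rep q Gen_c) (tauvec X) = tauvec (app (opC q) X)"
proof -
  have vec: "f = g" if "\<And>i j. f (i, j) = g (i, j)" for f g :: "nat \<times> mono \<Rightarrow> complex"
    using that by auto
  show "app (rep q Gen_a) (tauvec X) = tauvec (app opA X)"
    "app (rep q Gen_b) (tauvec X) = tauvec (app (opB q) X)"
    "app (rep q Gen_c) (tauvec X) = tauvec (app (opC q) X)"
    by (rule vec; rename_tac i j; case_tac i rule: nat16_cases;
        simp add: op_defs tauvec_app tau_app app_zero; simp add: algebra_simps qq qqx)+
qed


lemma tauvec_phi_add: "tauvec (phi (x + y)) p = tauvec (phi x) p + tauvec (phi y) p"
proof -
  have "phi (x + y) = (\<lambda>j. phi x j + phi y j)" by (rule ext) (simp add: phi_simps)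
  then show ?thesis by (cases p) (simp add: tauvec_def app_add)
qed

lemma Phi_theta_one: "Phi (ea + ed) = tauvec (delta (0, 0, 0))"
proof -
  have "Phi (ea + ed) (i, m, n, k) = tauvec (delta (0, 0, 0)) (i, m, n, k)" for i m n k
    by (cases i rule: nat16_cases)
      (auto simp: Phi_def ev_simps op_defs tauvec_app tau_defs delta_def sg_def rot_def)
  then show ?thesis by auto
qed

text \<open>Both sides agree at 1 by \<open>Phi_theta_one\<close> and obey the same recursion under
  \<open>a\<close>, \<open>b\<close>, \<open>c\<close> by \<open>rep_tauvec\<close>. For general
  \<open>x\<close>, passing to the normal form \<open>comb f\<close> eliminates
  \<open>d\<close>.\<close>

lemma Phi_theta:
  assumes "x \<in> carrier (free_ring A_gens)"
  shows "Phi (x * (ea + ed)) = tauvec (phi x)"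
proof -
  have *: "Phi (y * (ea + ed)) = tauvec (phi y)" if "y \<in> carrier (free_ring {Gen_a, Gen_b, Gen_c})" for y
    using that
  proof (induction y rule: free_ring_induct)
    case (add x y)
    then show ?case
      by (intro ext) (simp add: distrib_right Phi_simps tauvec_phi_add)
  next
    case (scal z)
    have "phi (scal z) = (\<lambda>j. z * delta (0, 0, 0) j)" by (rule ext) (simp add: phi_def ev_scal)
    moreover have "Phi (scal z * (ea + ed)) p = z * Phi (ea + ed) p" for p
      by (simp add: Phi_def ev_mult ev_scal)
    ultimately show ?case
      by (intro ext) (auto simp: Phi_theta_one tauvec_def app_mult split: prod.split)
  next
    case (gen g x)
    have "Phi (gen g * x * (ea + ed)) = app (rep q g) (Phi (x * (ea + ed)))"
      by (simp add: Phi_def ev_mult ev_gen mult.assoc)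
    moreover have "phi (gen g * x) = app (repA q g) (phi x)"
      by (simp add: phi_def ev_mult ev_gen)
    moreover have "app (rep q g) (tauvec (phi x)) = tauvec (app (repA q g) (phi x))"
      using gen.hyps(1) rep_tauvec[of "phi x"] by (elim insertE emptyE) (simp_all only: repA.simps)
    ultimately show ?case
      by (simp only: gen.IH)
  qed
  obtain f where f: "x - comb f \<in> A.J q" using A_span[OF assms] .
  have "(x - comb f) * (ea + ed) \<in> O.J q"
    using f A_ideal_subset[of q] by (intro O.J_mult_right) auto
  then have "Phi ((x - comb f) * (ea + ed)) = (\<lambda>_. 0)"
    using Phi_eq_0_iff by blast
  moreover have "Phi (x * (ea + ed)) p = Phi ((x - comb f) * (ea + ed)) p + Phi (comb f * (ea + ed)) p" for p
    by (simp add: left_diff_distrib Phi_simps)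
  ultimately have "Phi (x * (ea + ed)) = Phi (comb f * (ea + ed))"
    by (intro ext) simp
  also have "\<dots> = tauvec (phi (comb f))"
  proof (rule *)
    have "ga \<in> carrier (free_ring {Gen_a, Gen_b, Gen_c})" "gb \<in> carrier (free_ring {Gen_a, Gen_b, Gen_c})"
      "gc \<in> carrier (free_ring {Gen_a, Gen_b, Gen_c})"
      by (simp_all add: gen_in_free_ring)
    then show "comb f \<in> carrier (free_ring {Gen_a, Gen_b, Gen_c})"
      unfolding comb_def by (intro sum_in_free_ring mult_in_free_ring power_in_free_ring scal_in_free_ring)
  qed
  also have "phi (comb f) = phi x"
    using phi_J[OF f] phi_simps(2)[of x "comb f"] by (metis ext right_minus_eq)
  finally show ?thesis .
qed

section \<open>The Hodge operator\<close>

definition sbas :: "falg list" where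
  "sbas = [ea * eb * ec * ed,
     - (ea * eb * ec) - scal (mu q) * eb * ec * ed, - (ea * eb * ed),
     scal (q^2) * ea * ec * ed, eb * ec * ed,
     - (ea * eb) + scal (2 * mu q) * eb * ed, ea * ec,
     scal (1 / (1 + q^2)) * (scal 2 * eb * ec - scal (q^2 * mu q) * ea * ed),
     scal (q^2 / (1 + q^2)) * (scal 2 * ea * ed + scal (mu q) * eb * ec),
     eb * ed, - (ec * ed),
     - ea - scal (mu q) * ed, - eb, scal (1 / q^2) * ec, ed, 1]"

lemma hodge_table_bas: "(e, s) \<in> hodge_table q \<longleftrightarrow> (\<exists>i<16. e = ebas ! i \<and> s = sbas ! i)"
proof -
  \<comment> \<open>The table lists the volume form second, whereas \<open>ebas\<close> has it
    last.\<close>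
  have *: "{x0, x15, x1, x2, x3, x4, x5, x6, x7, x8, x9, x10, x11, x12, x13, x14} =
    {x0, x1, x2, x3, x4, x5, x6, x7, x8, x9, x10, x11, x12, x13, x14, x15}"
    for x0 x1 x2 x3 x4 x5 x6 x7 x8 x9 x10 x11 x12 x13 x14 x15 :: "falg \<times> falg"
    by blast
  have "hodge_table q = set (zip ebas sbas)"
    unfolding hodge_table_def
    by (subst *) (simp only: ebas_def sbas_def zip_Cons_Cons zip_Nil list.set)
  moreover have "length ebas = 16" "length sbas = 16" by (simp_all add: ebas_def sbas_def)
  ultimately show ?thesis by (auto simp: set_zip)
qed

lemma Omega_eq: "Omega q = O.P q" "Omega_cls q = O.cl q"
  by (simp_all add: fun_eq_iff Omega_def Omega_cls_def)

lemma A_eq: "A_alg q = A.P q" "A_cls q = A.cl q"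
  by (simp_all add: fun_eq_iff A_alg_def A_cls_def)

lemma Omega_cls_simps:
  "Omega_cls q (x + y) = Omega_cls q x \<oplus>\<^bsub>Omega q\<^esub> Omega_cls q y"
  "Omega_cls q (x * y) = Omega_cls q x \<otimes>\<^bsub>Omega q\<^esub> Omega_cls q y"
  "Omega_cls q (- x) = \<ominus>\<^bsub>Omega q\<^esub> Omega_cls q x"
  "Omega_cls q (x - y) = Omega_cls q x \<ominus>\<^bsub>Omega q\<^esub> Omega_cls q y"
  "Omega_cls q 0 = \<zero>\<^bsub>Omega q\<^esub>"
  unfolding Omega_eq by (rule O.cl_add O.cl_mult O.cl_uminus O.cl_diff O.cl_zero UNIV_free_ring)+

lemma Omega_cls_eq_iff: "Omega_cls q x = Omega_cls q y \<longleftrightarrow> x - y \<in> O.J q"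
  unfolding Omega_eq by (simp add: O.cl_eq_iff)

lemma Omega_cls_eqI: "(\<And>i j. Phi x (i, j) = Phi y (i, j)) \<Longrightarrow> Omega_cls q x = Omega_cls q y"
  unfolding Omega_cls_eq_iff Phi_eq_0_iff[symmetric] by (auto simp: fun_eq_iff Phi_simps)

lemma carrier_Omega: "carrier (Omega q) = range (Omega_cls q)"
  unfolding Omega_eq O.carrier_P by auto

lemma carrier_A: "carrier (A_alg q) = A_cls q ` carrier (free_ring A_gens)"
  unfolding A_eq A.carrier_P ..

definition form :: "falg list \<Rightarrow> (nat \<Rightarrow> falg) \<Rightarrow> falg set" where
  "form es x = Omega_cls q (\<Sum>i<16. es ! i * x i)"

abbreviation coeffs :: "(nat \<Rightarrow> falg) \<Rightarrow> bool" where
  "coeffs x \<equiv> \<forall>i<16. x i \<in> carrier (free_ring A_gens)"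

lemma form_exhaust:
  assumes "w \<in> carrier (Omega q)"
  shows "\<exists>x. coeffs x \<and> w = form ebas x"
  using assms Omega_span unfolding carrier_Omega form_def by (auto simp: Omega_cls_eq_iff)

text \<open>By freeness the two coefficient families differ termwise by elements of the ideal, which
  any left factors preserve.\<close>

lemma form_cong:
  assumes "coeffs x" "coeffs y" "form ebas x = form ebas y"
  shows "form sbas x = form sbas y"
proof -
  have "(\<Sum>i<16. ebas ! i * (x i - y i)) \<in> O.J q"
    using assms(3) unfolding form_def Omega_cls_eq_iff by (simp add: right_diff_distrib sum_subtractf)
  then have "x i - y i \<in> O.J q" if "i < 16" for i
    using comb_J[of "\<lambda>i. x i - y i" i] assms(1,2) that by (simp add: diff_in_free_ring)
  then have "(\<Sum>i<16. sbas ! i * (x i - y i)) \<in> O.J q"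
    by (intro O.J_sum O.J_mult_left) auto
  then show ?thesis
    unfolding form_def Omega_cls_eq_iff by (simp add: right_diff_distrib sum_subtractf)
qed

lemma form_add: "form es (\<lambda>i. x i + y i) = form es x \<oplus>\<^bsub>Omega q\<^esub> form es y"
  by (simp add: form_def distrib_left sum.distrib Omega_cls_simps)

lemma form_mult: "form es (\<lambda>i. x i * y) = form es x \<otimes>\<^bsub>Omega q\<^esub> Omega_cls q y"
  by (simp add: form_def sum_distrib_right mult.assoc flip: Omega_cls_simps)

lemma form_unit: "i < 16 \<Longrightarrow> form es (\<lambda>j. if j = i then x else 0) = Omega_cls q (es ! i * x)"
  by (simp add: form_def if_distrib[of "\<lambda>x. _ * x"] sum.delta cong: if_cong)

lemma is_hodge_form:
  assumes "is_hodge q f" "coeffs x"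
  shows "f (form ebas x) = form sbas x"
proof -
  interpret ring "Omega q" by (rule ring_Omega)
  have clos: "Omega_cls q p \<in> carrier (Omega q)" for p by (simp add: carrier_Omega)
  have fc: "f w \<in> carrier (Omega q)" if "w \<in> carrier (Omega q)" for w
    using assms(1) that unfolding is_hodge_def by blast
  have add: "f (w \<oplus>\<^bsub>Omega q\<^esub> w') = f w \<oplus>\<^bsub>Omega q\<^esub> f w'" if "w \<in> carrier (Omega q)" "w' \<in> carrier (Omega q)" for w w'
    using assms(1) that unfolding is_hodge_def by blast
  have mult: "f (w \<otimes>\<^bsub>Omega q\<^esub> embed q y) = f w \<otimes>\<^bsub>Omega q\<^esub> embed q y"
    if "w \<in> carrier (Omega q)" "y \<in> carrier (A_alg q)" for w y
    using assms(1) that unfolding is_hodge_def by blast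
  have tab: "f (Omega_cls q (ebas ! i)) = Omega_cls q (sbas ! i)" if "i < 16" for i
    using assms(1) hodge_table_bas that unfolding is_hodge_def by blast
  have f0: "f (Omega_cls q 0) = Omega_cls q 0"
    using add[OF zero_closed zero_closed] fc[OF zero_closed]
    by (simp add: Omega_cls_simps)
  have unit: "f (Omega_cls q (ebas ! i * x i)) = Omega_cls q (sbas ! i * x i)" if "i < 16" for i
    using mult[OF clos, of "A_cls q (x i)" "ebas ! i"] assms(2) that
    by (simp add: embed_A_cls carrier_A tab Omega_cls_simps)
  have "f (Omega_cls q (\<Sum>i\<in>K. ebas ! i * x i)) = Omega_cls q (\<Sum>i\<in>K. sbas ! i * x i)" if "K \<subseteq> {..<16}" for K
  proof -
    have "finite K" using that by (rule finite_subset) simp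
    then show ?thesis using that
    proof induction
      case (insert i K)
      then show ?case
        using add[OF clos clos, of "ebas ! i * x i" "\<Sum>i\<in>K. ebas ! i * x i"] unit[of i]
        by (simp flip: Omega_cls_simps)
    qed (simp add: f0)
  qed
  then show ?thesis unfolding form_def by blast
qed

lemma is_hodge_unique:
  assumes "is_hodge q f" "is_hodge q g"
  shows "f = g"
proof (rule ext)
  fix w
  show "f w = g w"
  proof (cases "w \<in> carrier (Omega q)")
    case True
    then obtain x where "coeffs x" "w = form ebas x" using form_exhaust by blast
    then show ?thesis using is_hodge_form[OF assms(1)] is_hodge_form[OF assms(2)] by simp
  next
    case False
    then show ?thesis
      using assms unfolding is_hodge_def PiE_def extensional_def by simp
  qed
qed

text \<open>Coefficients are picked by choice; \<open>form_cong\<close> makes the result independent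
  of the pick, and linearity then holds because sums and right multiples of coefficients are again
  coefficients.\<close>

lemma is_hodge_exists: "\<exists>f. is_hodge q f"
proof -
  interpret ring "Omega q" by (rule ring_Omega)
  define f where "f = (\<lambda>w \<in> carrier (Omega q). form sbas (SOME x. coeffs x \<and> w = form ebas x))"
  have clos: "form es x \<in> carrier (Omega q)" for es x by (simp add: form_def carrier_Omega)
  have f: "f (form ebas x) = form sbas x" if "coeffs x" for x
  proof -
    define y where "y = (SOME y. coeffs y \<and> form ebas x = form ebas y)"
    have y: "coeffs y \<and> form ebas x = form ebas y"
      unfolding y_def by (rule someI[of _ x]) (simp add: that)
    have "form sbas y = form sbas x"
      by (rule form_cong[OF _ that]) (simp_all add: y)
    moreover have "f (form ebas x) = form sbas y"
      unfolding f_def y_def by (simp add: clos)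
    ultimately show ?thesis by simp
  qed
  have "is_hodge q f"
    unfolding is_hodge_def
  proof (intro conjI ballI)
    show "f \<in> carrier (Omega q) \<rightarrow>\<^sub>E carrier (Omega q)"
      by (auto simp: f_def clos)
  next
    fix w w' assume "w \<in> carrier (Omega q)" "w' \<in> carrier (Omega q)"
    then obtain x x' where x: "coeffs x" "w = form ebas x" "coeffs x'" "w' = form ebas x'"
      using form_exhaust by blast
    then have "coeffs (\<lambda>i. x i + x' i)" by (simp add: add_in_free_ring)
    from f[OF this] show "f (w \<oplus>\<^bsub>Omega q\<^esub> w') = f w \<oplus>\<^bsub>Omega q\<^esub> f w'"
      using x f by (simp add: form_add)
  next
    fix w y assume "w \<in> carrier (Omega q)" "y \<in> carrier (A_alg q)"
    then obtain x r where x: "coeffs x" "w = form ebas x" "r \<in> carrier (free_ring A_gens)" "y = A_cls q r"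
      using form_exhaust unfolding carrier_A by blast
    then have "coeffs (\<lambda>i. x i * r)" by (simp add: mult_in_free_ring)
    from f[OF this] show "f (w \<otimes>\<^bsub>Omega q\<^esub> embed q y) = f w \<otimes>\<^bsub>Omega q\<^esub> embed q y"
      using x f by (simp add: form_mult embed_A_cls)
  next
    fix t assume "t \<in> hodge_table q"
    then obtain i where i: "i < 16" "t = (ebas ! i, sbas ! i)"
      using hodge_table_bas by (cases t) blast
    have "coeffs (\<lambda>j. if j = i then 1 else 0)" by (simp add: one_in_free_ring zero_in_free_ring)
    from f[OF this] show "case t of (e, s) \<Rightarrow> f (Omega_cls q e) = Omega_cls q s"
      using i by (simp add: form_unit)
  qed
  then show ?thesis by (rule exI[of _ f])
qed

lemma hodge_form: "coeffs x \<Longrightarrow> hodge q (form ebas x) = form sbas x"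
  using is_hodge_form theI'[of "is_hodge q"] is_hodge_exists is_hodge_unique unfolding hodge_def by blast


section \<open>The Laplacian on functions\<close>

lemma extd_Omega_cls:
  "extd q k (Omega_cls q x) = (if even k then Omega_cls q (x * (ea + ed) - (ea + ed) * x)
     else Omega_cls q (- ((ea + ed) * x + x * (ea + ed))))"
proof -
  have "Omega_cls q (- ((ea + ed) * x - x * (ea + ed))) = Omega_cls q (x * (ea + ed) - (ea + ed) * x)"
    by simp
  then show ?thesis by (simp add: extd_def Let_def flip: Omega_cls_simps)
qed

lemma supp3_tau: "supp3 (app (tauA q - trunc) X)" "supp3 (app (tauB q) X)" "supp3 (app (tauC q) X)"
  "supp3 (app (tauD q - trunc) X)" "supp3 (app (box q) X)"
  by (auto simp: supp3_def tau_defs)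

lemma trunc_supp3: "supp3 X \<Longrightarrow> app trunc X = X"
  by (auto simp: supp3_def trunc_def)

lemma Phi_assoc:
  assumes "y \<in> carrier (free_ring A_gens)"
  shows "Phi ((ea + ed) * (s * y)) = app (ev (rep q) ((ea + ed) * s)) (emb 0 (phi y))"
    and "Phi (s * y * (ea + ed)) = app (ev (rep q) s) (tauvec (phi y))"
proof -
  show "Phi ((ea + ed) * (s * y)) = app (ev (rep q) ((ea + ed) * s)) (emb 0 (phi y))"
    using Phi_A[OF assms, of "(ea + ed) * s"] by (simp add: mult.assoc)
  have "Phi (s * y * (ea + ed)) = app (ev (rep q) s) (Phi (y * (ea + ed)))"
    unfolding mult.assoc Phi_def ev_mult by simp
  then show "Phi (s * y * (ea + ed)) = app (ev (rep q) s) (tauvec (phi y))"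
    by (simp add: Phi_theta[OF assms])
qed

text \<open>The star of a function is a volume form, whose products with theta would have degree 5
  and so vanish on either side.\<close>

lemma extd_codiff_0:
  assumes x: "x \<in> carrier (free_ring A_gens)"
  shows "extd q (0 - 1) (codiff q 0 (Omega_cls q x)) = Omega_cls q 0"
proof -
  let ?e = "ea * eb * ec * ed"
  have "hodge q (form ebas (\<lambda>i. if i = 0 then x else 0)) = form sbas (\<lambda>i. if i = 0 then x else 0)"
    by (rule hodge_form) (simp add: x zero_in_free_ring)
  then have h: "hodge q (Omega_cls q x) = Omega_cls q (?e * x)"
    by (simp add: form_unit ebas_def sbas_def)
  have "Omega_cls q (?e * x * (ea + ed) - (ea + ed) * (?e * x)) = Omega_cls q 0"
  proof (rule Omega_cls_eqI)
    fix i j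
    show "Phi (?e * x * (ea + ed) - (ea + ed) * (?e * x)) (i, j) = Phi 0 (i, j)"
      unfolding Phi_simps Phi_assoc[OF x]
      by (cases i rule: nat16_cases) (simp_all add: ev_simps op_defs tauvec_app)
  qed
  then have "extd q (4 - 0) (hodge q (Omega_cls q x)) = Omega_cls q 0"
    by (simp add: h extd_Omega_cls)
  moreover have "hodge q (form ebas (\<lambda>_. 0)) = form sbas (\<lambda>_. 0)"
    by (rule hodge_form) (simp add: zero_in_free_ring)
  then have "hodge q (Omega_cls q 0) = Omega_cls q 0"
    by (simp add: form_def)
  ultimately have "codiff q 0 (Omega_cls q x) = Omega_cls q 0"
    by (simp add: codiff_def)
  then show ?thesis by (simp add: extd_Omega_cls)
qed

text \<open>The function is followed through degrees 0, 1, 3, 4 and back to 0; at each stage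
  \<open>phi_surj\<close> supplies functions with the required coordinates.\<close>

lemma laplacian_phi:
  assumes x: "x \<in> carrier (free_ring A_gens)"
  obtains z where "z \<in> carrier (free_ring A_gens)" "phi z = app (box q) (phi x)"
    "laplacian q 0 (Omega_cls q x) = Omega_cls q z"
proof -
  define X where "X = phi x"
  have tX: "app trunc X = X" unfolding X_def by (rule trunc_supp3[OF phi_supp3[OF x]])
  obtain a where a: "a \<in> carrier (free_ring A_gens)" "phi a = app (tauA q - trunc) X"
    using phi_surj[OF supp3_tau(1)] .
  obtain b where b: "b \<in> carrier (free_ring A_gens)" "phi b = app (tauB q) X"
    using phi_surj[OF supp3_tau(2)] .
  obtain c where c: "c \<in> carrier (free_ring A_gens)" "phi c = app (tauC q) X"
    using phi_surj[OF supp3_tau(3)] .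
  obtain d where d: "d \<in> carrier (free_ring A_gens)" "phi d = app (tauD q - trunc) X"
    using phi_surj[OF supp3_tau(4)] .
  obtain z where z: "z \<in> carrier (free_ring A_gens)" "phi z = app (box q) X"
    using phi_surj[OF supp3_tau(5)] .
  define y where "y = (\<lambda>i::nat. if i = 1 then a else if i = 2 then b else if i = 3 then c else if i = 4 then d else 0)"
  have y: "coeffs y" using a(1) b(1) c(1) d(1) by (simp add: y_def zero_in_free_ring)
  let ?sa = "sbas ! 1" and ?sb = "sbas ! 2" and ?sc = "sbas ! 3" and ?sd = "sbas ! 4"
  let ?eta = "?sa * a + ?sb * b + ?sc * c + ?sd * d"
  have d0: "extd q 0 (Omega_cls q x) = form ebas y"
  proof -
    have "Omega_cls q (x * (ea + ed) - (ea + ed) * x) = Omega_cls q (\<Sum>i<16. ebas ! i * y i)"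
    proof (rule Omega_cls_eqI)
      fix i j
      have "app trunc X j = X j" by (simp add: tX)
      moreover have "Phi (\<Sum>i<16. ebas ! i * y i) (i, j) = (if i < 16 then phi (y i) j else 0)"
        by (rule Phi_comb) (use y in blast)
      ultimately show "Phi (x * (ea + ed) - (ea + ed) * x) (i, j) = Phi (\<Sum>i<16. ebas ! i * y i) (i, j)"
        unfolding Phi_simps Phi_theta[OF x] Phi_A[OF x]
        by (cases i rule: nat16_cases)
          (simp_all add: y_def a b c d phi_simps ev_simps op_defs tauvec_app flip: X_def)
    qed
    then show ?thesis by (simp add: extd_Omega_cls form_def)
  qed
  have h: "hodge q (form ebas y) = Omega_cls q ?eta"
    using hodge_form[OF y] by (simp add: form_def[of sbas] sum_16 y_def)
  have d3: "extd q 3 (Omega_cls q ?eta) = form ebas (\<lambda>i. if i = 15 then z else 0)"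
  proof -
    have "Omega_cls q (- ((ea + ed) * ?eta + ?eta * (ea + ed))) = Omega_cls q (ebas ! 15 * z)"
    proof (rule Omega_cls_eqI)
      fix i j
      \<comment> \<open>On coordinates of actual functions \<open>trunc\<close> is the identity, so
        the operator identity \<open>box_eq\<close> becomes an identity of values.\<close>
      have "app trunc (phi a) = phi a" "app trunc (phi d) = phi d"
        by (rule trunc_supp3[OF phi_supp3[OF a(1)]], rule trunc_supp3[OF phi_supp3[OF d(1)]])
      then have bx: "app (box q) X j = - ((1 - q) * (app (tauA q) (phi a) j - phi a j) - (app (tauD q) (phi a) j - phi a j)
          + app (tauC q) (phi b) j + (- 1 - q) * app (tauB q) (phi c) j - (app (tauA q) (phi d) j - phi d j))"
        by (subst box_eq) (simp add: q_simps flip: a(2) b(2) c(2) d(2))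
      have eta: "Phi ((ea + ed) * ?eta) p = app (ev (rep q) ((ea + ed) * ?sa)) (emb 0 (phi a)) p
           + app (ev (rep q) ((ea + ed) * ?sb)) (emb 0 (phi b)) p
           + app (ev (rep q) ((ea + ed) * ?sc)) (emb 0 (phi c)) p
           + app (ev (rep q) ((ea + ed) * ?sd)) (emb 0 (phi d)) p"
        "Phi (?eta * (ea + ed)) p = app (ev (rep q) ?sa) (tauvec (phi a)) p
           + app (ev (rep q) ?sb) (tauvec (phi b)) p
           + app (ev (rep q) ?sc) (tauvec (phi c)) p
           + app (ev (rep q) ?sd) (tauvec (phi d)) p" for p
        unfolding distrib_left[of "ea + ed"] distrib_right[of _ _ "ea + ed"] Phi_simps
          Phi_assoc[OF a(1)] Phi_assoc[OF b(1)] Phi_assoc[OF c(1)] Phi_assoc[OF d(1)] by simp_all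
      show "Phi (- ((ea + ed) * ?eta + ?eta * (ea + ed))) (i, j) = Phi (ebas ! 15 * z) (i, j)"
        unfolding Phi_simps eta Phi_A[OF z(1)] z(2) ebas_emb[of 15, simplified] emb_app bx
        by (cases i rule: nat16_cases)
          (simp_all add: sbas_def ev_simps op_defs tauvec_app q_simps, simp_all add: algebra_simps qq qqx)
    qed
    then show ?thesis by (simp add: extd_Omega_cls form_unit)
  qed
  have "hodge q (form ebas (\<lambda>i. if i = 15 then z else 0)) = form sbas (\<lambda>i. if i = 15 then z else 0)"
    by (rule hodge_form) (simp add: z zero_in_free_ring)
  moreover have "sbas ! 15 = 1" by (simp add: sbas_def)
  ultimately have h15: "hodge q (form ebas (\<lambda>i. if i = 15 then z else 0)) = Omega_cls q z"
    using form_unit[of 15 sbas z] by simp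
  have "4 - (0 + 1) = (3 :: int)" by simp
  then have "codiff q (0 + 1) (extd q 0 (Omega_cls q x)) = Omega_cls q z"
    by (simp only: codiff_def d0 h d3 h15)
  then have "laplacian q 0 (Omega_cls q x) = Omega_cls q z"
    unfolding laplacian_def extd_codiff_0[OF x] by (simp flip: Omega_cls_simps)
  then show thesis using that[OF z(1)] z(2) by (simp add: X_def)
qed

end

section \<open>Kernel and eigenvectors\<close>

text \<open>The recursion imitates that of \<open>Span\<close> through
  \<open>line_extension\<close>, so that \<open>Span_A\<close> goes by induction on the
  list.\<close>

fun lspan :: "('j \<Rightarrow> complex) list \<Rightarrow> ('j \<Rightarrow> complex) set" where
  "lspan [] = {\<lambda>j. 0}"
| "lspan (v # vs) = {\<lambda>j. z * v j + w j | z w. w \<in> lspan vs}"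

lemma lspan_zero_at: "w \<in> lspan vs \<Longrightarrow> \<forall>v\<in>set vs. v j = 0 \<Longrightarrow> w j = 0"
  by (induction vs arbitrary: w) auto

lemma lspan_app:
  assumes "\<And>v. v \<in> set vs \<Longrightarrow> app X v = (\<lambda>j. 0)" "w \<in> lspan vs"
  shows "app X w = (\<lambda>j. 0)"
  using assms by (induction vs arbitrary: w) (auto simp: app_zero app_add app_mult)

fun lcomb :: "complex list \<Rightarrow> ('j \<Rightarrow> complex) list \<Rightarrow> 'j \<Rightarrow> complex" where
  "lcomb (z # zs) (v # vs) j = z * v j + lcomb zs vs j"
| "lcomb _ _ j = 0"

lemma lcomb_lspan: "length zs = length vs \<Longrightarrow> lcomb zs vs \<in> lspan vs"
proof (induction zs vs rule: list_induct2)
  case (Cons z zs v vs)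
  then show ?case by (auto intro!: exI[of _ z] exI[of _ "lcomb zs vs"])
qed auto

context cuberoot
begin

lemma A_cls_eq_iff:
  assumes "x \<in> carrier (free_ring A_gens)" "y \<in> carrier (free_ring A_gens)"
  shows "A_cls q x = A_cls q y \<longleftrightarrow> phi x = phi y"
proof -
  have "A_cls q x = A_cls q y \<longleftrightarrow> phi (x - y) = (\<lambda>_. 0)"
    unfolding A_eq A.cl_eq_iff[OF assms] by (rule phi_eq_0_iff[OF diff_in_free_ring[OF assms], symmetric])
  then show ?thesis by (simp add: fun_eq_iff phi_simps)
qed

lemma Span_A:
  assumes "set ps \<subseteq> carrier (free_ring A_gens)"
  shows "ring.Span (A_alg q) (A_scalars q) (map (A_cls q) ps) =
    A_cls q ` {x \<in> carrier (free_ring A_gens). phi x \<in> lspan (map phi ps)}"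
  using assms
proof (induction ps)
  case Nil
  interpret ring "A_alg q" by (rule ring_A_alg)
  have "A_cls q ` {x \<in> carrier (free_ring A_gens). phi x = (\<lambda>j. 0)} = {\<zero>\<^bsub>A_alg q\<^esub>}"
  proof -
    have "A_cls q x = \<zero>\<^bsub>A_alg q\<^esub>" if "x \<in> carrier (free_ring A_gens)" "phi x = (\<lambda>j. 0)" for x
      using that A.cl_eq_zero_iff[OF that(1)] phi_eq_0_iff[OF that(1)] by (simp add: A_eq)
    moreover have "A_cls q 0 = \<zero>\<^bsub>A_alg q\<^esub>" by (simp add: A_eq A.cl_zero)
    moreover have "phi 0 = (\<lambda>j. 0)" by (rule ext) (simp add: phi_simps)
    ultimately show ?thesis using zero_in_free_ring[of A_gens] by (auto simp: image_iff)
  qed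
  then show ?case by simp
next
  case (Cons p ps)
  interpret ring "A_alg q" by (rule ring_A_alg)
  let ?F = "carrier (free_ring A_gens)"
  let ?E = "{x \<in> ?F. phi x \<in> lspan (map phi ps)}"
  have p: "p \<in> ?F" using Cons.prems by simp
  have IH: "Span (A_scalars q) (map (A_cls q) ps) = A_cls q ` ?E" using Cons by simp
  have scal: "A_scalars q \<subseteq> carrier (A_alg q)"
    by (auto simp: A_scalars_def carrier_A scal_in_free_ring)
  have "A_cls q p \<in> carrier (A_alg q)" "A_cls q ` ?E \<subseteq> carrier (A_alg q)"
    using p by (auto simp: carrier_A)
  then have sub: "line_extension (A_scalars q) (A_cls q p) (A_cls q ` ?E) \<subseteq> carrier (A_alg q)"
    using scal by (intro line_extension_in_carrier)
  have "A_cls q x \<in> line_extension (A_scalars q) (A_cls q p) (A_cls q ` ?E) \<longleftrightarrow>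
      phi x \<in> lspan (map phi (p # ps))" if x: "x \<in> ?F" for x
  proof -
    have "A_cls q x \<in> line_extension (A_scalars q) (A_cls q p) (A_cls q ` ?E) \<longleftrightarrow>
        (\<exists>z. \<exists>v\<in>?E. x - (scal z * p + v) \<in> A.J q)"
      unfolding A_eq A_scalars_def by (rule A.line_extension_cl[OF x p]) blast
    also have "\<dots> \<longleftrightarrow> (\<exists>z. \<exists>v\<in>?E. phi x = (\<lambda>j. z * phi p j + phi v j))"
    proof -
      have "x - (scal z * p + v) \<in> A.J q \<longleftrightarrow> phi x = (\<lambda>j. z * phi p j + phi v j)" if "v \<in> ?E" for z v
      proof -
        have "x - (scal z * p + v) \<in> ?F" using x p that by (auto intro!: free_ring_closed)
        then show ?thesis
          by (simp add: fun_eq_iff phi_simps flip: phi_eq_0_iff)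
      qed
      then show ?thesis by blast
    qed
    also have "\<dots> \<longleftrightarrow> phi x \<in> lspan (map phi (p # ps))"
    proof
      assume "phi x \<in> lspan (map phi (p # ps))"
      then obtain z w where w: "phi x = (\<lambda>j. z * phi p j + w j)" "w \<in> lspan (map phi ps)" by auto
      have "phi (x - scal z * p) = w" by (rule ext) (simp add: phi_simps w(1))
      moreover have "x - scal z * p \<in> ?F" using x p by (intro free_ring_closed)
      ultimately show "\<exists>z. \<exists>v\<in>?E. phi x = (\<lambda>j. z * phi p j + phi v j)"
        using w by (intro exI[of _ z] bexI[of _ "x - scal z * p"]) auto
    qed auto
    finally show ?thesis .
  qed
  moreover have "Span (A_scalars q) (map (A_cls q) (p # ps)) =
      line_extension (A_scalars q) (A_cls q p) (A_cls q ` ?E)"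
    using IH by simp
  ultimately show ?case
    using sub by (auto simp: carrier_A simp del: lspan.simps list.map Span.simps)
qed

fun triangular :: "(falg \<times> mono) list \<Rightarrow> bool" where
  "triangular [] \<longleftrightarrow> True"
| "triangular ((p, j) # ps) \<longleftrightarrow> p \<in> carrier (free_ring A_gens) \<and> phi p j \<noteq> 0 \<and>
     (\<forall>(p', _) \<in> set ps. phi p' j = 0) \<and> triangular ps"

lemma triangular_carrier: "triangular ps \<Longrightarrow> set (map fst ps) \<subseteq> carrier (free_ring A_gens)"
  by (induction ps rule: triangular.induct) auto

text \<open>A combination of the later vectors vanishes at the pivot \<open>j\<close>, where the
  current vector does not.\<close>

lemma independent_A: "triangular ps \<Longrightarrow> ring.independent (A_alg q) (A_scalars q) (map (A_cls q) (map fst ps))"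
proof (induction ps rule: triangular.induct)
  case 1
  interpret ring "A_alg q" by (rule ring_A_alg)
  show ?case by simp
next
  case (2 p j ps)
  interpret ring "A_alg q" by (rule ring_A_alg)
  have "A_cls q p \<notin> Span (A_scalars q) (map (A_cls q) (map fst ps))"
  proof
    assume "A_cls q p \<in> Span (A_scalars q) (map (A_cls q) (map fst ps))"
    then obtain x where x: "x \<in> carrier (free_ring A_gens)" "A_cls q p = A_cls q x"
      "phi x \<in> lspan (map phi (map fst ps))"
      using Span_A[of "map fst ps"] triangular_carrier[of ps] "2.prems" by auto
    then have "phi p = phi x" using A_cls_eq_iff "2.prems" by simp
    moreover have "phi x j = 0"
      by (rule lspan_zero_at[OF x(3)]) (use "2.prems" in auto)
    ultimately show False using "2.prems" by simp
  qed
  then show ?case using 2 by (auto intro!: li_Cons simp: carrier_A)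
qed

lemma harmonic0_eq: "harmonic0 q = A_cls q ` {x \<in> carrier (free_ring A_gens). app (box q) (phi x) = (\<lambda>j. 0)}"
proof -
  have "laplacian q 0 (embed q (A_cls q x)) = \<zero>\<^bsub>Omega q\<^esub> \<longleftrightarrow> app (box q) (phi x) = (\<lambda>j. 0)"
    if x: "x \<in> carrier (free_ring A_gens)" for x
  proof -
    obtain z where z: "z \<in> carrier (free_ring A_gens)" "phi z = app (box q) (phi x)"
      "laplacian q 0 (Omega_cls q x) = Omega_cls q z"
      using laplacian_phi[OF x] .
    have "Omega_cls q z = \<zero>\<^bsub>Omega q\<^esub> \<longleftrightarrow> z \<in> O.J q"
      using Omega_cls_eq_iff[of z 0] by (simp add: Omega_cls_simps)
    also have "\<dots> \<longleftrightarrow> Phi z = (\<lambda>_. 0)" by (simp add: Phi_eq_0_iff)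
    \<comment> \<open>Functions embed injectively into forms: the coordinates of \<open>z\<close> as
      a form are those of \<open>z\<close> placed at the unit form.\<close>
    also have "\<dots> \<longleftrightarrow> phi z = (\<lambda>_. 0)"
      using Phi_A[OF z(1), of 1] by (auto simp: fun_eq_iff)
    finally show ?thesis by (simp add: embed_A_cls[OF x] z)
  qed
  then show ?thesis by (auto simp: harmonic0_def carrier_A)
qed

definition kernel_basis :: "falg list" where
  "kernel_basis = [1, ga, gb, gc, gd,
     ga * gb^2, ga^2 * gb, gd * gb^2, gd^2 * gb,
     ga * gc^2, ga^2 * gc, gd * gc^2, gd^2 * gc]"

definition eigen_basis :: "falg list" where
  "eigen_basis = [ga^2, gb^2, gc^2, gd^2, ga * gb, ga * gc, gd * gb, gd * gc, gb * gc - 1]"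

lemmas phi_eval = phi_def ev_simps opA_def opB_def opC_def opD_def rot_numeral delta_def power2_eq_square
  numeral_2_eq_2[symmetric] algebra_simps qq qqx q0

text \<open>Since d is a^2 and d^2 is a, up to terms containing b c, factors \<open>gd\<close> and
  \<open>gd^2\<close> contribute exponents 2 and 1 to the pivots.\<close>

lemma triangular_kernel:
  "triangular (zip kernel_basis [(0, 0, 0), (1, 0, 0), (0, 1, 0), (0, 0, 1), (2, 0, 0),
     (1, 2, 0), (2, 1, 0), (2, 2, 0), (1, 1, 0), (1, 0, 2), (2, 0, 1), (2, 0, 2), (1, 0, 1)])"
  unfolding kernel_basis_def zip_Cons_Cons zip_Nil triangular.simps list.set
  by (simp add: phi_eval q2 q3 qpow,
      intro conjI mult_in_free_ring diff_in_free_ring one_in_free_ring gen_A)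

lemma triangular_eigen:
  "triangular (zip eigen_basis [(2, 0, 0), (0, 2, 0), (0, 0, 2), (1, 0, 0), (1, 1, 0), (1, 0, 1),
     (2, 1, 0), (2, 0, 1), (0, 0, 0)])"
  unfolding eigen_basis_def zip_Cons_Cons zip_Nil triangular.simps list.set
  by (simp add: phi_eval q2 q3 qpow,
      intro conjI mult_in_free_ring diff_in_free_ring one_in_free_ring gen_A)

lemma mono_fun_eqI:
  fixes f g :: "mono \<Rightarrow> complex"
  assumes "supp3 f" "supp3 g" "\<forall>m\<in>{0, 1, 2}. \<forall>n\<in>{0, 1, 2}. \<forall>k\<in>{0, 1, 2}. f (m, n, k) = g (m, n, k)"
  shows "f = g"
proof (rule ext)
  have case3: "m < 3 \<Longrightarrow> m \<in> {0, 1, 2}" for m :: nat by auto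
  fix p :: mono
  obtain m n k where p: "p = (m, n, k)" by (cases p)
  show "f p = g p"
    unfolding p using assms case3 unfolding supp3_def by metis
qed

lemma box_kernel:
  assumes "p \<in> set kernel_basis"
  shows "app (box q) (phi p) = (\<lambda>j. 0)"
proof -
  have "\<forall>p\<in>set kernel_basis. \<forall>m\<in>{0, 1, 2}. \<forall>n\<in>{0, 1, 2}. \<forall>k\<in>{0, 1, 2}. app (box q) (phi p) (m, n, k) = 0"
    unfolding kernel_basis_def list.set
    by (simp only: ball_simps; intro conjI TrueI; simp add: box_def sg_def phi_eval q2 q3 qpow)
  then show ?thesis using assms by (intro mono_fun_eqI supp3_tau) (auto simp: supp3_def)
qed

lemma box_eigen:
  assumes "p \<in> set eigen_basis"
  shows "app (box q) (phi p) = (\<lambda>j. 6 * (q + 1) * phi p j)"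
proof -
  have "\<forall>p\<in>set eigen_basis. \<forall>m\<in>{0, 1, 2}. \<forall>n\<in>{0, 1, 2}. \<forall>k\<in>{0, 1, 2}.
      app (box q) (phi p) (m, n, k) = 6 * (q + 1) * phi p (m, n, k)"
    unfolding eigen_basis_def list.set
    by (simp only: ball_simps; intro conjI TrueI; simp add: box_def sg_def phi_eval q2 q3 qpow)
  moreover have "p \<in> carrier (free_ring A_gens)"
    using assms triangular_carrier[OF triangular_eigen] by (auto simp: eigen_basis_def)
  then have "supp3 (\<lambda>j. 6 * (q + 1) * phi p j)"
    using phi_supp3 by (simp add: supp3_def)
  ultimately show ?thesis using assms by (intro mono_fun_eqI supp3_tau) auto
qed

lemma supp3_lcomb: "(\<And>v. v \<in> set vs \<Longrightarrow> supp3 v) \<Longrightarrow> supp3 (lcomb zs vs)"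
  by (induction zs vs rule: list_induct2') (simp_all add: supp3_def)

lemma box_zero_lspan:
  assumes "supp3 X" "app (box q) X = (\<lambda>j. 0)"
  shows "X \<in> lspan (map phi kernel_basis)"
proof -
  have q1': "q + 1 \<noteq> 0"
    using qq q0 by (auto simp: eq_neg_iff_add_eq_0[symmetric])
  have q1'': "q \<noteq> - 1" using q1' by (simp add: eq_neg_iff_add_eq_0)
  have q6: "6 * q + 6 \<noteq> 0"
  proof -
    have "6 * q + 6 = 6 * (q + 1)" by simp
    then show ?thesis using q1' by (simp only: mult_eq_0_iff) simp
  qed
  have q6': "- (6 * q) \<noteq> 6" using q6 by (metis add.right_inverse)
  have z: "app (box q) X p = 0" for p by (simp add: assms(2))
  note box_eval = box_def sg_def q0 q1' q1'' q6 q6' q2 q3 qpow numeral_2_eq_2[symmetric]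
  \<comment> \<open>Each of these rows has a single nonzero entry: the shift alone where the
    exponent sum is not 2 modulo 3, the diagonal alone where the shift would leave the
    range.\<close>
  have X0: "X (0, 1, 1) = 0" "X (0, 1, 2) = 0" "X (0, 2, 1) = 0" "X (0, 0, 2) = 0" "X (0, 2, 0) = 0"
    "X (1, 1, 1) = 0" "X (1, 2, 2) = 0" "X (2, 1, 2) = 0" "X (2, 2, 1) = 0"
    using z[of "(0, 0, 0)"] z[of "(0, 0, 1)"] z[of "(0, 1, 0)"] z[of "(0, 0, 2)"] z[of "(0, 2, 0)"]
      z[of "(1, 0, 0)"] z[of "(1, 2, 2)"] z[of "(2, 1, 2)"] z[of "(2, 2, 1)"]
    by (simp_all add: box_eval)
  have X1: "X (0, 2, 2) = 0" "X (2, 2, 2) = 0"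
    using z[of "(0, 1, 1)"] z[of "(2, 1, 1)"] X0 by (simp_all add: box_eval)
  \<comment> \<open>The factor is the inverse of q, the ratio of the two coefficients of
    \<open>gd\<close>; in \<open>X3\<close> the factor - q is that of \<open>gd^2 * gc\<close> and
    \<open>gd^2 * gb\<close>.\<close>
  have X2: "X (2, 1, 1) = (- 1 - q) * X (2, 0, 0)"
  proof -
    have "6 * (X (2, 1, 1) - (- 1 - q) * X (2, 0, 0)) = 0"
      using z[of "(2, 0, 0)"] by (simp add: box_eval algebra_simps)
    then show ?thesis by simp
  qed
  have inv: "x = (- 1 - q) * (q * x)" for x by (simp add: algebra_simps qq qqx)
  have "6 * (q * X (1, 1, 2) - (q + 1) * X (1, 0, 1)) = 0" "6 * (q * X (1, 2, 1) - (q + 1) * X (1, 1, 0)) = 0"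
    using z[of "(1, 0, 1)"] z[of "(1, 1, 0)"] by (simp_all add: box_eval algebra_simps)
  then have "q * X (1, 1, 2) = (q + 1) * X (1, 0, 1)" "q * X (1, 2, 1) = (q + 1) * X (1, 1, 0)"
    by simp_all
  then have X3: "X (1, 1, 2) = - q * X (1, 0, 1)" "X (1, 2, 1) = - q * X (1, 1, 0)"
    using inv[of "X (1, 1, 2)"] inv[of "X (1, 2, 1)"] by (simp_all add: algebra_simps qq qqx)
  \<comment> \<open>At the pivots of \<open>triangular_kernel\<close> the basis is dual: each vector
    is 1 at its own pivot and 0 at the others. So the coefficients are the values of
    \<open>X\<close> there.\<close>
  define zs where "zs = [X (0, 0, 0), X (1, 0, 0), X (0, 1, 0), X (0, 0, 1), X (2, 0, 0),
     X (1, 2, 0), X (2, 1, 0), X (2, 2, 0), X (1, 1, 0), X (1, 0, 2), X (2, 0, 1), X (2, 0, 2), X (1, 0, 1)]"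
  have "X = lcomb zs (map phi kernel_basis)"
  proof (rule mono_fun_eqI[OF assms(1)])
    have "supp3 v" if "v \<in> set (map phi kernel_basis)" for v
      using that triangular_carrier[OF triangular_kernel] phi_supp3 by (auto simp: kernel_basis_def)
    then show "supp3 (lcomb zs (map phi kernel_basis))"
      by (rule supp3_lcomb)
    show "\<forall>m\<in>{0, 1, 2}. \<forall>n\<in>{0, 1, 2}. \<forall>k\<in>{0, 1, 2}. X (m, n, k) = lcomb zs (map phi kernel_basis) (m, n, k)"
      unfolding zs_def kernel_basis_def list.map lcomb.simps
      by (simp only: ball_simps; intro conjI TrueI;
          simp add: phi_eval X0 X1 X2 X3 X0[unfolded One_nat_def] X2[unfolded One_nat_def] X3[unfolded One_nat_def])
  qed
  then show ?thesis using lcomb_lspan[of zs "map phi kernel_basis"] by (simp add: zs_def kernel_basis_def)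
qed

lemma Span_kernel_basis:
  "ring.Span (A_alg q) (A_scalars q) (map (A_cls q) kernel_basis) = harmonic0 q"
proof -
  have "set kernel_basis \<subseteq> carrier (free_ring A_gens)"
    using triangular_carrier[OF triangular_kernel] by (simp add: kernel_basis_def)
  moreover have "phi x \<in> lspan (map phi kernel_basis) \<longleftrightarrow> app (box q) (phi x) = (\<lambda>j. 0)"
    if "x \<in> carrier (free_ring A_gens)" for x
    using box_zero_lspan[OF phi_supp3[OF that]] lspan_app[of "map phi kernel_basis" "box q"] box_kernel
    by auto
  ultimately show ?thesis
    unfolding harmonic0_eq by (subst Span_A) auto
qed

lemma laplacian_eigen_basis:
  assumes "p \<in> set eigen_basis"
  shows "laplacian q 0 (embed q (A_cls q p)) =
    Omega_cls q (scal (6 * (q + 1))) \<otimes>\<^bsub>Omega q\<^esub> embed q (A_cls q p)"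
proof -
  have p: "p \<in> carrier (free_ring A_gens)"
    using assms triangular_carrier[OF triangular_eigen] by (auto simp: eigen_basis_def)
  obtain z where z: "z \<in> carrier (free_ring A_gens)" "phi z = app (box q) (phi p)"
    "laplacian q 0 (Omega_cls q p) = Omega_cls q z"
    using laplacian_phi[OF p] .
  have cp: "scal (6 * (q + 1)) * p \<in> carrier (free_ring A_gens)"
    by (intro mult_in_free_ring scal_in_free_ring p)
  have "phi z = phi (scal (6 * (q + 1)) * p)"
    unfolding z(2) box_eigen[OF assms] by (rule ext) (simp only: phi_simps)
  then have "Phi z = Phi (scal (6 * (q + 1)) * p)"
    using Phi_A[OF z(1), of 1] Phi_A[OF cp, of 1] by simp
  then have "Omega_cls q z = Omega_cls q (scal (6 * (q + 1)) * p)"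
    by (intro Omega_cls_eqI) simp
  then show ?thesis by (simp only: embed_A_cls[OF p] z(3) Omega_cls_simps(2))
qed

end

theorem proposition4p5:
  fixes q :: complex
  assumes "q ^ 3 = 1" and "q \<noteq> 1"
  shows
    "let B = map (A_cls q)
           [1, ga, gb, gc, gd,
            ga * gb^2, ga^2 * gb, gd * gb^2, gd^2 * gb,
            ga * gc^2, ga^2 * gc, gd * gc^2, gd^2 * gc];
         E = map (A_cls q)
           [ga^2, gb^2, gc^2, gd^2, ga * gb, ga * gc, gd * gb, gd * gc, gb * gc - 1]
     in ring.dimension (A_alg q) 13 (A_scalars q) (harmonic0 q) \<and>
        ring.independent (A_alg q) (A_scalars q) B \<and>
        ring.Span (A_alg q) (A_scalars q) B = harmonic0 q \<and>
        ring.independent (A_alg q) (A_scalars q) E \<and>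
        (\<forall>v \<in> set E. laplacian q 0 (embed q v)
           = Omega_cls q (scal (6 * (q + 1))) \<otimes>\<^bsub>Omega q\<^esub> embed q v)"
proof -
  interpret cuberoot q using assms by unfold_locales
  have B: "ring.independent (A_alg q) (A_scalars q) (map (A_cls q) kernel_basis)"
    using independent_A[OF triangular_kernel] by (simp only: kernel_basis_def zip_Cons_Cons zip_Nil list.map fst_conv)
  have E: "ring.independent (A_alg q) (A_scalars q) (map (A_cls q) eigen_basis)"
    using independent_A[OF triangular_eigen] by (simp only: eigen_basis_def zip_Cons_Cons zip_Nil list.map fst_conv)
  have "length (map (A_cls q) kernel_basis) = 13" by (simp add: kernel_basis_def)
  then have dim: "ring.dimension (A_alg q) 13 (A_scalars q) (harmonic0 q)"
    using ring.dimension_independent[OF ring_A_alg B] by (simp only: Span_kernel_basis)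
  have "\<forall>v \<in> set (map (A_cls q) eigen_basis). laplacian q 0 (embed q v)
      = Omega_cls q (scal (6 * (q + 1))) \<otimes>\<^bsub>Omega q\<^esub> embed q v"
    using laplacian_eigen_basis by auto
  with dim B E Span_kernel_basis show ?thesis
    unfolding Let_def kernel_basis_def eigen_basis_def by (intro conjI)
qed

end
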